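(* Let $\nu>-\frac12$ and let $\mathbf{m}=\begin{pmatrix}a&b\\c&d\end{pmatrix}\in SL(2,\mathbb{R})$ with $b\neq 0$. For each $f\in\mathcal{E}_*(\mathbb{R})$, the problem $$\Delta_{\nu,x}^{\mathbf{m}}u(x,y)=\Delta_{\nu,y}^{\mathbf{m}}u(x,y),\qquad u(x,0)=f(x),\qquad \frac{\partial u}{\partial y}(x,0)=0\qquad (x,y\ge 0),$$ has a unique solution, given by $$u(x,y)=e^{\frac{i}{2}\frac{d}{b}(x^{2}+y^{2})}\,T_{x}^{\nu}\left[s\mapsto e^{-\frac{i}{2}\frac{d}{b}s^{2}}f(s)\right](y).$$
   Context: $\mathcal{E}_*(\mathbb{R})$ is the space of even $\mathcal{C}^\infty$ functions on $\mathbb{R}$. The operator $\Delta_\nu^{\mathbf{m}}$ acts on functions $g$ of one variable $x$ by $$\Delta_\nu^{\mathbf{m}}g(x)=g''(x)+\left(\frac{2\nu+1}{x}-2i\frac{d}{b}x\right)g'(x)-\left(\frac{d^2}{b^2}x^2+2i(\nu+1)\frac{d}{b}\right)g(x),$$ where $b,d$ are entries of $\mathbf{m}$; $\Delta_{\nu,x}^{\mathbf{m}}$ and $\Delta_{\nu,y}^{\mathbf{m}}$ denote this operator acting in the variable $x$, respectively $y$. The generalized translation associated with the Bessel operator $\frac{d^2}{dx^2}+\frac{2\nu+1}{x}\frac{d}{dx}$ is $$T_x^\nu g(y)=\frac{\Gamma(\nu+1)}{\sqrt{\pi}\,\Gamma(\nu+1/2)}\int_0^\pi g\left(\sqrt{x^2+y^2-2xy\cos\theta}\right)(\sin\theta)^{2\nu}\,d\theta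 .$$ *)

theory Defs
  imports "HOL-Analysis.Analysis"
begin

definition smooth_real :: "(real \<Rightarrow> complex) \<Rightarrow> bool" where
  "smooth_real f \<longleftrightarrow>
     (\<forall>n x. ((\<lambda>h t. vector_derivative h (at t)) ^^ n) f differentiable (at x))"

definition even_smooth :: "(real \<Rightarrow> complex) set" where
  "even_smooth = {f. smooth_real f \<and> (\<forall>x. f (- x) = f x)}"

(* The term with 1/x makes the value at x = 0 meaningless (division by zero is 0 in HOL);
   the operator is only used at x > 0. *)
definition canonical_bessel_op ::
    "real \<Rightarrow> real^2^2 \<Rightarrow> (real \<Rightarrow> complex) \<Rightarrow> real \<Rightarrow> complex" where
  "canonical_bessel_op \<nu> m g x =
     (let b = m $ 1 $ 2; d = m $ 2 $ 2;
          g' = (\<lambda>t. vector_derivative g (at t));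
          g'' = (\<lambda>t. vector_derivative g' (at t))
      in g'' x
         + (of_real ((2 * \<nu> + 1) / x) - 2 * \<i> * of_real (d / b) * of_real x) * g' x
         - (of_real (d\<^sup>2 / b\<^sup>2 * x\<^sup>2) + 2 * \<i> * of_real (\<nu> + 1) * of_real (d / b)) * g x)"

(* For \<nu> < 0 the weight is singular at 0 and pi, where HOL assigns it the value 0; likewise
   0 powr 0 = 0 when \<nu> = 0.  Two points do not affect the integral. *)
definition bessel_translation ::
    "real \<Rightarrow> real \<Rightarrow> (real \<Rightarrow> complex) \<Rightarrow> real \<Rightarrow> complex" where
  "bessel_translation \<nu> x g y =
     of_real (Gamma (\<nu> + 1) / (sqrt pi * Gamma (\<nu> + 1/2))) *
     integral {0..pi}
       (\<lambda>\<theta>. g (sqrt (x\<^sup>2 + y\<^sup>2 - 2 * x * y * cos \<theta>)) * of_real (sin \<theta> powr (2 * \<nu>)))"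

(* One-sided at x = 0 and y = 0, two-sided elsewhere on the closed quadrant. *)
definition partial_x :: "(real \<Rightarrow> real \<Rightarrow> complex) \<Rightarrow> real \<Rightarrow> real \<Rightarrow> complex" where
  "partial_x u x y = vector_derivative (\<lambda>s. u s y) (at x within {0..})"

definition partial_y :: "(real \<Rightarrow> real \<Rightarrow> complex) \<Rightarrow> real \<Rightarrow> real \<Rightarrow> complex" where
  "partial_y u x y = vector_derivative (\<lambda>t. u x t) (at y within {0..})"

definition C1_quadrant :: "(real \<Rightarrow> real \<Rightarrow> complex) \<Rightarrow> bool" where
  "C1_quadrant u \<longleftrightarrow>
     (\<forall>x\<ge>0. \<forall>y\<ge>0. (\<lambda>s. u s y) differentiable (at x within {0..}) \<and>
                  (\<lambda>t. u x t) differentiable (at y within {0..})) \<and>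
     continuous_on ({0..} \<times> {0..}) (\<lambda>(x, y). u x y) \<and>
     continuous_on ({0..} \<times> {0..}) (\<lambda>(x, y). partial_x u x y) \<and>
     continuous_on ({0..} \<times> {0..}) (\<lambda>(x, y). partial_y u x y)"

definition C2_quadrant :: "(real \<Rightarrow> real \<Rightarrow> complex) \<Rightarrow> bool" where
  "C2_quadrant u \<longleftrightarrow>
     C1_quadrant u \<and> C1_quadrant (partial_x u) \<and> C1_quadrant (partial_y u)"

(* Classical solutions: C^2 up to the boundary of the quadrant.  The equation is imposed
   where the coefficients 1/x and 1/y make sense; at the boundary it holds in the limit.
   Values of u outside the quadrant are irrelevant. *)
definition canonical_bessel_problem ::
    "real \<Rightarrow> real^2^2 \<Rightarrow> (real \<Rightarrow> complex) \<Rightarrow> (real \<Rightarrow> real \<Rightarrow> complex) \<Rightarrow> bool" where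
  "canonical_bessel_problem \<nu> m f u \<longleftrightarrow>
     C2_quadrant u \<and>
     (\<forall>x>0. \<forall>y>0. canonical_bessel_op \<nu> m (\<lambda>s. u s y) x = canonical_bessel_op \<nu> m (\<lambda>t. u x t) y) \<and>
     (\<forall>x\<ge>0. u x 0 = f x) \<and>
     (\<forall>x\<ge>0. partial_y u x 0 = 0)"

end

theory Submission
  imports Defs
begin

text \<open>
  Write \<open>c = d/b\<close> and \<open>\<alpha> = 2\<nu> + 1 > 0\<close>. The operator is the Bessel operator
  \<open>h'' + (\<alpha>/x) h'\<close> conjugated by the chirp \<open>exp (\<i> c x\<^sup>2 / 2)\<close>: substituting
  \<open>u(x,y) = exp (\<i> c (x\<^sup>2 + y\<^sup>2) / 2) w(x,y)\<close> turns the problem into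
  \<open>w\<^sub>x\<^sub>x + (\<alpha>/x) w\<^sub>x = w\<^sub>y\<^sub>y + (\<alpha>/y) w\<^sub>y\<close> with \<open>w(x,0) = exp (- \<i> c x\<^sup>2 / 2) f(x)\<close> and
  \<open>w\<^sub>y(x,0) = 0\<close>. Solutions of the two problems correspond to each other in both directions
  (\<open>canonical_bessel_problem_of_bessel\<close>, \<open>bessel_problem_of_canonical\<close>).

  Existence. An even smooth function is a \<open>C\<^sup>2\<close> function \<open>G\<close> of the square of its argument
  (\<open>even_smooth_function_of_square\<close>), and so is its product with a chirp. Hence the integrand
  \<open>G(x\<^sup>2 + y\<^sup>2 - 2xy cos \<theta>)\<close> of the translation contains no square root and is \<open>C\<^sup>2\<close> in \<open>(x,y)\<close>,
  including at the points where the square root vanishes. Differentiating under the integral sign,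
  the difference of the two Bessel operators applied to the integrand, times \<open>(sin \<theta>)\<^bsup>2\<nu>\<^esup>\<close>, is a
  multiple of the \<open>\<theta>\<close>-derivative of \<open>2 (sin \<theta>)\<^bsup>2\<nu>+1\<^esup> G'(x\<^sup>2 + y\<^sup>2 - 2xy cos \<theta>)\<close>, which vanishes at
  both ends of \<open>[0,\<pi>]\<close> (\<open>integral_angular_kernel_identity\<close>). At \<open>y = 0\<close> the same identity gives
  \<open>w\<^sub>y = 0\<close>, and the normalising constant gives the initial value.

  Uniqueness. Let \<open>w\<close> have zero data and \<open>\<phi>(s) = max(0, R - s)\<^sup>2\<close>. The energy
  \<open>E(y) = \<integral>\<^sub>0\<^sup>R \<phi>(x+y) x\<^sup>\<alpha> (|w\<^sub>x|\<^sup>2 + |w\<^sub>y|\<^sup>2) dx\<close> starts at 0. Modulo the integral of the \<open>x\<close>-derivative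
  of \<open>2 \<phi>(x+y) x\<^sup>\<alpha> (w\<^sub>x \<bullet> w\<^sub>y)\<close>, which is 0, its derivative has the integrand
  \<open>\<phi>' x\<^sup>\<alpha> |w\<^sub>x - w\<^sub>y|\<^sup>2 - 2 (\<alpha>/y) \<phi> x\<^sup>\<alpha> |w\<^sub>y|\<^sup>2 \<le> 0\<close>. So \<open>E\<close> vanishes, \<open>w\<^sub>y = 0\<close>, and \<open>w = 0\<close>
  (\<open>bessel_problem_zero_imp_zero\<close>). The factor \<open>\<phi>(x+y)\<close> encodes unit speed of propagation and keeps
  the interval of integration fixed.
\<close>

section \<open>Integrals with a parameter against an integrable weight\<close>

lemma has_vector_derivative_compose_real:
  assumes "(g has_real_derivative g') (at x within S)" "(f has_vector_derivative f') (at (g x))"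
  shows "((\<lambda>x. f (g x)) has_vector_derivative g' *\<^sub>R f') (at x within S)"
  using vector_diff_chain_within[of g g' x S f f'] assms
  by (simp add: o_def has_real_derivative_iff_has_vector_derivative has_vector_derivative_at_within)

lemma has_vector_derivative_imp_continuous_on:
  assumes "\<And>x. (f has_vector_derivative f' x) (at x)"
  shows "continuous_on S f"
  using assms by (meson continuous_at_imp_continuous_on has_vector_derivative_continuous)

text \<open>
  For \<open>\<nu> < 0\<close> the weight \<open>(sin \<theta>)\<^bsup>2\<nu>\<^esup>\<close> is unbounded, so parameter integrals against it fall outside
  the theorems for jointly continuous integrands. Absolute integrability of the weight is enough, since
  the other factor is continuous on a compact interval.
\<close>
lemma absolutely_integrable_weighted:
  fixes f :: "real \<Rightarrow> 'a::euclidean_space" and k :: "real \<Rightarrow> real"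
  assumes f: "continuous_on {a..b} f" and k: "k absolutely_integrable_on {a..b}"
  shows "(\<lambda>t. k t *\<^sub>R f t) absolutely_integrable_on {a..b}"
proof -
  have "bilinear (\<lambda>(x::'a) (r::real). r *\<^sub>R x)"
    by (auto simp: bilinear_def intro!: linearI scaleR_add_left scaleR_add_right)
  moreover have "f \<in> borel_measurable (lebesgue_on {a..b})"
    using f by (intro continuous_imp_measurable_on_sets_lebesgue) auto
  moreover have "bounded (f ` {a..b})"
    using f by (intro compact_imp_bounded compact_continuous_image) auto
  ultimately show ?thesis
    using k absolutely_integrable_bounded_measurable_product[of "\<lambda>(x::'a) (r::real). r *\<^sub>R x" f "{a..b}" k]
    by auto
qed

lemma integrable_weighted:
  fixes f :: "real \<Rightarrow> 'a::euclidean_space" and k :: "real \<Rightarrow> real"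
  assumes "continuous_on {a..b} f" "k absolutely_integrable_on {a..b}"
  shows "(\<lambda>t. k t *\<^sub>R f t) integrable_on {a..b}"
  using absolutely_integrable_weighted[OF assms] by (rule set_lebesgue_integral_eq_integral(1))

lemma norm_integral_weighted_le:
  fixes f :: "real \<Rightarrow> 'a::euclidean_space" and k :: "real \<Rightarrow> real"
  assumes f: "continuous_on {a..b} f" and k: "k absolutely_integrable_on {a..b}"
    and le: "\<And>t. t \<in> {a..b} \<Longrightarrow> norm (f t) \<le> B"
  shows "norm (integral {a..b} (\<lambda>t. k t *\<^sub>R f t)) \<le> B * integral {a..b} (\<lambda>t. \<bar>k t\<bar>)"
proof -
  have "(\<lambda>t. \<bar>k t\<bar>) integrable_on {a..b}"
    using k by (simp add: absolutely_integrable_on_def)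
  then have i: "(\<lambda>t. B * \<bar>k t\<bar>) integrable_on {a..b}"
    by (rule integrable_on_mult_right)
  have "norm (integral {a..b} (\<lambda>t. k t *\<^sub>R f t)) \<le> integral {a..b} (\<lambda>t. B * \<bar>k t\<bar>)"
    by (rule integral_norm_bound_integral[OF integrable_weighted[OF f k] i])
       (use le in \<open>auto simp: mult.commute[of B] intro!: mult_left_mono\<close>)
  then show ?thesis by simp
qed

lemma continuous_on_section:
  assumes "continuous_on (U \<times> C) (\<lambda>(x, t). f x t)" "x \<in> U"
  shows "continuous_on C (f x)"
proof -
  have "continuous_on C (\<lambda>t. (\<lambda>(x, t). f x t) (x, t))"
    by (rule continuous_on_compose2[OF assms(1)]) (use assms(2) in \<open>auto intro!: continuous_intros\<close>)
  then show ?thesis by simp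
qed

text \<open>
  Near a parameter value the integrand changes by a uniformly small amount over the compact interval,
  and the integral by at most that amount times the total mass of \<open>\<bar>k\<bar>\<close>.
\<close>
lemma continuous_on_weighted_integral:
  fixes f :: "'p::topological_space \<Rightarrow> real \<Rightarrow> 'a::euclidean_space" and k :: "real \<Rightarrow> real"
  assumes f: "continuous_on (U \<times> {a..b}) (\<lambda>(x, t). f x t)"
    and k: "k absolutely_integrable_on {a..b}"
  shows "continuous_on U (\<lambda>x. integral {a..b} (\<lambda>t. k t *\<^sub>R f x t))"
  unfolding continuous_on_def
proof (intro strip tendstoI)
  fix x and e :: real assume x: "x \<in> U" and "e > 0"
  define K where "K = integral {a..b} (\<lambda>t. \<bar>k t\<bar>)"
  have "K \<ge> 0" unfolding K_def by (rule integral_nonneg) (use k in \<open>auto simp: absolutely_integrable_on_def\<close>)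
  define e' where "e' = e / (K + 1)"
  have "e' > 0" "e' * K < e"
    using \<open>e > 0\<close> \<open>K \<ge> 0\<close> by (auto simp: e'_def field_simps add_pos_nonneg intro!: mult_strict_left_mono)
  obtain X0 where X0: "x \<in> X0" "open X0"
    and le: "\<And>y t. y \<in> X0 \<inter> U \<Longrightarrow> t \<in> {a..b} \<Longrightarrow> norm (f y t - f x t) \<le> e'"
    using continuous_on_prod_compactE[OF f compact_Icc x \<open>e' > 0\<close>]
    unfolding split_beta fst_conv snd_conv dist_norm by metis
  have "\<forall>\<^sub>F y in at x within U. y \<in> X0 \<inter> U"
    using X0 eventually_at_topological by auto
  then show "\<forall>\<^sub>F y in at x within U. dist (integral {a..b} (\<lambda>t. k t *\<^sub>R f y t))
      (integral {a..b} (\<lambda>t. k t *\<^sub>R f x t)) < e"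
  proof eventually_elim
    case (elim y)
    have c: "continuous_on {a..b} (f y)" "continuous_on {a..b} (f x)"
      using continuous_on_section[OF f] elim x by auto
    have "integral {a..b} (\<lambda>t. k t *\<^sub>R f y t) - integral {a..b} (\<lambda>t. k t *\<^sub>R f x t)
        = integral {a..b} (\<lambda>t. k t *\<^sub>R (f y t - f x t))"
      using integrable_weighted[OF c(1) k] integrable_weighted[OF c(2) k]
      by (simp add: scaleR_diff_right integral_diff)
    moreover have "norm (integral {a..b} (\<lambda>t. k t *\<^sub>R (f y t - f x t))) \<le> e' * K"
      unfolding K_def by (rule norm_integral_weighted_le) (use le elim c k in \<open>auto intro!: continuous_intros\<close>)
    ultimately show ?case
      using \<open>e' * K < e\<close> by (simp add: dist_norm)
  qed
qed

text \<open>
  By the mean value inequality the error of the linear approximation is \<open>\<bar>y - x\<bar>\<close> times the oscillation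
  of \<open>f'\<close> near \<open>x\<close>, which is uniformly small in \<open>t\<close>; integrating against \<open>k\<close> costs a factor
  \<open>\<integral>\<bar>k\<bar>\<close>.
\<close>
lemma has_vector_derivative_weighted_integral:
  fixes f :: "real \<Rightarrow> real \<Rightarrow> 'a::euclidean_space" and k :: "real \<Rightarrow> real"
  assumes der: "\<And>x t. t \<in> {a..b} \<Longrightarrow> ((\<lambda>x. f x t) has_vector_derivative f' x t) (at x)"
    and f: "\<And>x. continuous_on {a..b} (f x)"
    and f': "continuous_on (UNIV \<times> {a..b}) (\<lambda>(x, t). f' x t)"
    and k: "k absolutely_integrable_on {a..b}"
  shows "((\<lambda>x. integral {a..b} (\<lambda>t. k t *\<^sub>R f x t)) has_vector_derivative
            integral {a..b} (\<lambda>t. k t *\<^sub>R f' x t)) (at x)"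
  unfolding has_vector_derivative_def has_derivative_within_alt2
proof (intro conjI allI impI bounded_linear_scaleR_left)
  fix e :: real assume "e > 0"
  define K where "K = integral {a..b} (\<lambda>t. \<bar>k t\<bar>)"
  have "K \<ge> 0" unfolding K_def by (rule integral_nonneg) (use k in \<open>auto simp: absolutely_integrable_on_def\<close>)
  define e' where "e' = e / (K + 1)"
  have "e' > 0" "e' * K \<le> e"
    using \<open>e > 0\<close> \<open>K \<ge> 0\<close> by (auto simp: e'_def field_simps add_pos_nonneg)
  obtain X0 where X0: "x \<in> X0" "open X0"
    and le: "\<And>y t. y \<in> X0 \<Longrightarrow> t \<in> {a..b} \<Longrightarrow> norm (f' y t - f' x t) \<le> e'"
    using continuous_on_prod_compactE[OF f' compact_Icc UNIV_I \<open>e' > 0\<close>]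
    unfolding split_beta fst_conv snd_conv dist_norm by (metis Int_UNIV_right)
  then obtain r where r: "r > 0" "ball x r \<subseteq> X0" using openE by blast
  have "\<forall>\<^sub>F y in at x. y \<in> ball x r"
    using r by (metis centre_in_ball eventually_at_in_open' open_ball)
  then show "\<forall>\<^sub>F y in at x. norm (integral {a..b} (\<lambda>t. k t *\<^sub>R f y t) - integral {a..b} (\<lambda>t. k t *\<^sub>R f x t) -
      (y - x) *\<^sub>R integral {a..b} (\<lambda>t. k t *\<^sub>R f' x t)) \<le> e * norm (y - x)"
  proof eventually_elim
    case (elim y)
    have c': "continuous_on {a..b} (f' x)"
      using continuous_on_section[OF f'] by auto
    have lin: "norm (f y t - f x t - (y - x) *\<^sub>R f' x t) \<le> norm (y - x) * e'" if t: "t \<in> {a..b}" for t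
    proof (rule vector_differentiable_bound_linearization[where S = "ball x r" and f' = "\<lambda>x. f' x t"])
      show "closed_segment x y \<subseteq> ball x r"
        using elim r by (intro closed_segment_subset) auto
    qed (use der[OF t] le[OF _ t] r in \<open>auto intro: has_vector_derivative_at_within\<close>)
    have "integral {a..b} (\<lambda>t. k t *\<^sub>R f y t) - integral {a..b} (\<lambda>t. k t *\<^sub>R f x t)
          - (y - x) *\<^sub>R integral {a..b} (\<lambda>t. k t *\<^sub>R f' x t)
        = integral {a..b} (\<lambda>t. k t *\<^sub>R f y t - k t *\<^sub>R f x t - (y - x) *\<^sub>R (k t *\<^sub>R f' x t))"
      using integrable_weighted[OF f[of y] k] integrable_weighted[OF f[of x] k] integrable_weighted[OF c' k]
      by (simp add: integral_diff integrable_diff integrable_cmul del: scaleR_scaleR)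
    also have "\<dots> = integral {a..b} (\<lambda>t. k t *\<^sub>R (f y t - f x t - (y - x) *\<^sub>R f' x t))"
      by (simp add: algebra_simps)
    finally have "norm (integral {a..b} (\<lambda>t. k t *\<^sub>R f y t) - integral {a..b} (\<lambda>t. k t *\<^sub>R f x t)
          - (y - x) *\<^sub>R integral {a..b} (\<lambda>t. k t *\<^sub>R f' x t)) \<le> (norm (y - x) * e') * K"
      unfolding K_def
      by (simp only:, intro norm_integral_weighted_le lin k continuous_on_diff continuous_on_scaleR
            continuous_on_const f c')
    also have "\<dots> = norm (y - x) * (e' * K)" by simp
    also have "\<dots> \<le> norm (y - x) * e" by (rule mult_left_mono) (use \<open>e' * K \<le> e\<close> in auto)
    finally show ?case by (simp only: mult.commute)
  qed
qed

section \<open>Even smooth functions as functions of the square\<close>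

lemma continuous_on_real_imp_antiderivative:
  fixes K :: "real \<Rightarrow> 'a::euclidean_space"
  assumes "continuous_on UNIV K"
  obtains F where "F 0 = c" "\<And>x. (F has_vector_derivative K x) (at x)"
proof -
  obtain F where F: "\<And>x. (F has_vector_derivative K x) (at x)"
    using einterval_antiderivative[of "-\<infinity>" "\<infinity>" K] assms
    by (auto simp: continuous_on_eq_continuous_at)
  show ?thesis
    by (rule that[of "\<lambda>x. F x - F 0 + c"]) (auto intro!: derivative_eq_intros F)
qed

lemma has_vector_derivative_eq_0_imp_eq:
  fixes f :: "real \<Rightarrow> 'a::real_normed_vector"
  assumes "\<And>x. (f has_vector_derivative 0) (at x)"
  shows "f x = f y"
proof -
  obtain c where "\<And>x. x \<in> UNIV \<Longrightarrow> f x = c"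
    by (rule has_vector_derivative_zero_constant[of UNIV f]) (use assms in auto)
  then show ?thesis by simp
qed

lemma derivative_even_odd:
  fixes f :: "real \<Rightarrow> 'a::real_normed_vector"
  assumes "\<And>x. (f has_vector_derivative f' x) (at x)" and "\<And>x. f (- x) = c *\<^sub>R f x"
  shows "f' (- x) = - c *\<^sub>R f' x"
proof -
  have "((\<lambda>x. f (- x)) has_vector_derivative (- 1) *\<^sub>R f' (- x)) (at x)"
    by (rule has_vector_derivative_compose_real[OF _ assms(1)]) (auto intro!: derivative_eq_intros)
  moreover have "((\<lambda>x. f (- x)) has_vector_derivative c *\<^sub>R f' x) (at x)"
    unfolding assms(2) using assms(1) by (auto intro!: derivative_eq_intros)
  ultimately have "(- 1) *\<^sub>R f' (- x) = c *\<^sub>R f' x"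
    by (rule vector_derivative_unique_at)
  then show ?thesis by (metis minus_minus scaleR_minus1_left scaleR_minus_left)
qed

text \<open>
  The quotient of an odd smooth function by its argument is \<open>\<integral>\<^sub>0\<^sup>1 h'(tx) dt\<close>, which is visibly smooth
  at the origin; its \<open>n\<close>-th derivative is \<open>\<integral>\<^sub>0\<^sup>1 t\<^sup>n h\<^bsup>(n+1)\<^esup>(tx) dt\<close>. A smooth function is represented
  here by the sequence of its derivatives.
\<close>
lemma odd_smooth_eq_scaleR_even_smooth:
  fixes h :: "nat \<Rightarrow> real \<Rightarrow> complex"
  assumes h: "\<And>n x. (h n has_vector_derivative h (Suc n) x) (at x)"
    and odd: "\<And>x. h 0 (- x) = - h 0 x"
  obtains q where "\<And>n x. (q n has_vector_derivative q (Suc n) x) (at x)"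
    and "\<And>x. h 0 x = x *\<^sub>R q 0 x" and "\<And>x. q 0 (- x) = q 0 x"
proof
  define q where "q = (\<lambda>n x. integral {0..1} (\<lambda>t. t ^ n *\<^sub>R h (Suc n) (t * x)))"
  have c: "continuous_on S (h n)" for n S
    using h by (rule has_vector_derivative_imp_continuous_on)
  have der: "((\<lambda>x. h n (t * x)) has_vector_derivative t *\<^sub>R h (Suc n) (t * x)) (at x)" for n t x
    by (rule has_vector_derivative_compose_real[OF _ h]) (auto intro!: derivative_eq_intros)
  show "(q n has_vector_derivative q (Suc n) x) (at x)" for n x
  proof -
    have "((\<lambda>x. integral (cbox 0 1) (\<lambda>t. t ^ n *\<^sub>R h (Suc n) (t * x))) has_vector_derivative
           integral (cbox 0 1) (\<lambda>t. t ^ Suc n *\<^sub>R h (Suc (Suc n)) (t * x))) (at x)"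
    proof (rule leibniz_rule_vector_derivative)
      show "((\<lambda>x. t ^ n *\<^sub>R h (Suc n) (t * x)) has_vector_derivative t ^ Suc n *\<^sub>R h (Suc (Suc n)) (t * x)) (at x within UNIV)" for x t
        using bounded_linear.has_vector_derivative[OF bounded_linear_scaleR_right der[of "Suc n" t x], of "t ^ n"]
        by (simp add: mult.commute)
      show "(\<lambda>t. t ^ n *\<^sub>R h (Suc n) (t * x)) integrable_on cbox 0 1" for x
        by (intro integrable_continuous continuous_intros continuous_on_compose2[OF c]) auto
      show "continuous_on (UNIV \<times> cbox 0 1) (\<lambda>(x, t). t ^ Suc n *\<^sub>R h (Suc (Suc n)) (t * x))"
        unfolding split_beta by (intro continuous_intros continuous_on_compose2[OF c]) auto
    qed auto
    then show ?thesis by (simp add: q_def)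
  qed
  show "h 0 x = x *\<^sub>R q 0 x" for x
  proof -
    have "((\<lambda>t. h 0 (t * x)) has_vector_derivative x *\<^sub>R h (Suc 0) (t * x)) (at t)" for t
      by (rule has_vector_derivative_compose_real[OF _ h]) (auto intro!: derivative_eq_intros)
    then have "((\<lambda>t. x *\<^sub>R h (Suc 0) (t * x)) has_integral h 0 (1 * x) - h 0 (0 * x)) {0..1}"
      by (intro fundamental_theorem_of_calculus) (auto intro: has_vector_derivative_at_within)
    moreover have "h 0 0 = 0" using odd[of 0] by (simp add: equal_neg_zero)
    ultimately show ?thesis by (simp add: q_def has_integral_iff)
  qed
  have "h (Suc 0) (- x) = h (Suc 0) x" for x
    using derivative_even_odd[of "h 0" "h (Suc 0)" "-1"] h[of 0] odd by auto
  then show "q 0 (- x) = q 0 x" for x by (simp add: q_def)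
qed

text \<open>
  The part of Whitney's theorem on even functions that two derivatives require. If \<open>f(s) = G(s\<^sup>2)\<close> then
  \<open>f'(s) = s p(s)\<close> with \<open>p(s) = 2 G'(s\<^sup>2)\<close>, and \<open>p'(s) = s q(s)\<close> with \<open>q(s) = 4 G''(s\<^sup>2)\<close>. Dividing by \<open>s\<close>
  twice yields \<open>p\<close> and \<open>q\<close>, and integrating \<open>q(sqrt r) / 4\<close> twice recovers \<open>G\<close>. As \<open>sqrt\<close> is
  continuous on all of \<open>\<real>\<close>, \<open>G\<close> is \<open>C\<^sup>2\<close> on the whole line and not only on the half-line.
\<close>
lemma even_smooth_function_of_square:
  assumes "f \<in> even_smooth"
  obtains G G1 G2 where "\<And>r. (G has_vector_derivative G1 r) (at r)"
    "\<And>r. (G1 has_vector_derivative G2 r) (at r)" "continuous_on UNIV G2" "\<And>s. f s = G (s\<^sup>2)"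
proof -
  define D where "D = (\<lambda>n. ((\<lambda>h t. vector_derivative h (at t)) ^^ n) f)"
  have D: "(D n has_vector_derivative D (Suc n) x) (at x)" for n x
    using assms by (auto simp: even_smooth_def smooth_real_def D_def vector_derivative_works)
  have D0: "D 0 = f" by (simp add: D_def)
  have "f (- x) = f x" for x using assms by (auto simp: even_smooth_def)
  then have odd: "D (Suc 0) (- x) = - D (Suc 0) x" for x
    using derivative_even_odd[OF D[of 0], of 1 x] by (simp add: D0)
  obtain p where p: "\<And>n x. (p n has_vector_derivative p (Suc n) x) (at x)"
    and Dp: "\<And>x. D (Suc 0) x = x *\<^sub>R p 0 x" and p0: "\<And>x. p 0 (- x) = p 0 x"
    using odd_smooth_eq_scaleR_even_smooth[of "\<lambda>n. D (Suc n)", OF D odd] by blast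
  have podd: "p (Suc 0) (- x) = - p (Suc 0) x" for x
    using derivative_even_odd[OF p[of 0], of 1 x] p0 by simp
  obtain q where q: "\<And>n x. (q n has_vector_derivative q (Suc n) x) (at x)"
    and pq: "\<And>x. p (Suc 0) x = x *\<^sub>R q 0 x" and q0: "\<And>x. q 0 (- x) = q 0 x"
    using odd_smooth_eq_scaleR_even_smooth[of "\<lambda>n. p (Suc n)", OF p podd] by blast
  have "continuous_on UNIV (\<lambda>r. q 0 (sqrt r))"
    by (rule continuous_on_compose2[OF has_vector_derivative_imp_continuous_on[OF q, of UNIV]])
       (auto intro: continuous_on_real_sqrt continuous_on_id)
  then have K: "continuous_on UNIV (\<lambda>r. q 0 (sqrt r) / 4)"
    by (rule continuous_on_divide) auto
  obtain G1 where G1: "G1 0 = p 0 0 / 2" "\<And>r. (G1 has_vector_derivative q 0 (sqrt r) / 4) (at r)"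
    using continuous_on_real_imp_antiderivative[OF K, of "p 0 0 / 2"] by blast
  from G1(2) have "continuous_on UNIV G1"
    by (rule has_vector_derivative_imp_continuous_on)
  then obtain G where G: "G 0 = f 0" "\<And>r. (G has_vector_derivative G1 r) (at r)"
    using continuous_on_real_imp_antiderivative[of G1 "f 0"] by blast
  have sq: "((\<lambda>s. s\<^sup>2) has_real_derivative 2 * s) (at s)" for s :: real
    by (auto intro!: derivative_eq_intros)
  have G1p: "G1 (s\<^sup>2) = p 0 s / 2" for s
  proof -
    have "((\<lambda>s. G1 (s\<^sup>2) - p 0 s / 2) has_vector_derivative 0) (at s)" for s
    proof -
      have "((\<lambda>s. G1 (s\<^sup>2)) has_vector_derivative (2 * s) *\<^sub>R (q 0 (sqrt (s\<^sup>2)) / 4)) (at s)"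
        by (rule has_vector_derivative_compose_real[OF sq G1(2)])
      moreover have "q 0 (sqrt (s\<^sup>2)) = q 0 s" by (simp add: q0 abs_if)
      ultimately have "((\<lambda>s. G1 (s\<^sup>2) - p 0 s / 2) has_vector_derivative
          (2 * s) *\<^sub>R (q 0 s / 4) - p (Suc 0) s / 2) (at s)"
        by (intro has_vector_derivative_diff has_vector_derivative_divide p) simp
      then show ?thesis by (simp add: pq scaleR_conv_of_real)
    qed
    from has_vector_derivative_eq_0_imp_eq[OF this, of s 0] show ?thesis using G1(1) by simp
  qed
  have "f s = G (s\<^sup>2)" for s
  proof -
    have "((\<lambda>s. G (s\<^sup>2) - f s) has_vector_derivative 0) (at s)" for s
    proof -
      have "((\<lambda>s. G (s\<^sup>2)) has_vector_derivative (2 * s) *\<^sub>R G1 (s\<^sup>2)) (at s)"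
        by (rule has_vector_derivative_compose_real[OF sq G(2)])
      moreover have "(f has_vector_derivative D (Suc 0) s) (at s)" using D[of 0 s] by (simp add: D0)
      ultimately have "((\<lambda>s. G (s\<^sup>2) - f s) has_vector_derivative
          (2 * s) *\<^sub>R G1 (s\<^sup>2) - D (Suc 0) s) (at s)"
        by (rule has_vector_derivative_diff)
      then show ?thesis by (simp add: Dp G1p scaleR_conv_of_real)
    qed
    from has_vector_derivative_eq_0_imp_eq[OF this, of s 0] show ?thesis using G(1) by simp
  qed
  then show ?thesis by (rule that[OF G(2) G1(2) K])
qed

section \<open>Calculus on the closed quadrant\<close>

lemma at_within_Ici_interior: "x > 0 \<Longrightarrow> at x within {0..} = at x" for x :: real
  by (rule at_within_interior) simp

lemma at_within_Ici_nontrivial: "x \<ge> 0 \<Longrightarrow> at x within {0..} \<noteq> bot" for x :: real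
  using at_within_Ici_interior[of x] at_within_Ici_at_right[of "0::real"]
  by (cases "x = 0") auto

lemma continuous_on_case_prod:
  fixes f g :: "'a::topological_space \<Rightarrow> 'b::topological_space \<Rightarrow> 'c::real_normed_algebra"
  assumes "continuous_on S (\<lambda>(x, y). f x y)" "continuous_on S (\<lambda>(x, y). g x y)"
  shows "continuous_on S (\<lambda>(x, y). f x y - g x y)"
    and "continuous_on S (\<lambda>(x, y). f x y + g x y)"
    and "continuous_on S (\<lambda>(x, y). f x y * g x y)"
  using continuous_on_diff[OF assms] continuous_on_add[OF assms] continuous_on_mult[OF assms]
  by (simp_all add: split_beta)

lemma partial_x_eqI:
  assumes "x \<ge> 0" "((\<lambda>s. u s y) has_vector_derivative d) (at x within {0..})"
  shows "partial_x u x y = d"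
  unfolding partial_x_def by (rule vector_derivative_within[OF at_within_Ici_nontrivial]) (use assms in auto)

lemma partial_y_eqI:
  assumes "y \<ge> 0" "((\<lambda>t. u x t) has_vector_derivative d) (at y within {0..})"
  shows "partial_y u x y = d"
  unfolding partial_y_def by (rule vector_derivative_within[OF at_within_Ici_nontrivial]) (use assms in auto)

lemma C1_quadrantD:
  assumes "C1_quadrant u"
  shows "x \<ge> 0 \<Longrightarrow> y \<ge> 0 \<Longrightarrow> ((\<lambda>s. u s y) has_vector_derivative partial_x u x y) (at x within {0..})"
    and "x \<ge> 0 \<Longrightarrow> y \<ge> 0 \<Longrightarrow> ((\<lambda>t. u x t) has_vector_derivative partial_y u x y) (at y within {0..})"
    and "continuous_on ({0..} \<times> {0..}) (\<lambda>(x, y). u x y)"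
    and "continuous_on ({0..} \<times> {0..}) (\<lambda>(x, y). partial_x u x y)"
    and "continuous_on ({0..} \<times> {0..}) (\<lambda>(x, y). partial_y u x y)"
  using assms unfolding C1_quadrant_def partial_x_def partial_y_def by (auto simp: vector_derivative_works)

text \<open>
  One-sided derivatives within the quadrant are unique, so the candidates agree with the partial
  derivatives there, which thus are continuous as well.
\<close>
lemma C1_quadrantI:
  assumes "\<And>x y. x \<ge> 0 \<Longrightarrow> y \<ge> 0 \<Longrightarrow> ((\<lambda>s. u s y) has_vector_derivative ux x y) (at x within {0..})"
    and "\<And>x y. x \<ge> 0 \<Longrightarrow> y \<ge> 0 \<Longrightarrow> ((\<lambda>t. u x t) has_vector_derivative uy x y) (at y within {0..})"
    and "continuous_on ({0..} \<times> {0..}) (\<lambda>(x, y). u x y)"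
    and "continuous_on ({0..} \<times> {0..}) (\<lambda>(x, y). ux x y)"
    and "continuous_on ({0..} \<times> {0..}) (\<lambda>(x, y). uy x y)"
  shows "C1_quadrant u"
proof -
  have "continuous_on ({0..} \<times> {0..}) (\<lambda>(x, y). partial_x u x y)"
    using assms(4) by (rule continuous_on_eq) (auto simp: partial_x_eqI[OF _ assms(1)])
  moreover have "continuous_on ({0..} \<times> {0..}) (\<lambda>(x, y). partial_y u x y)"
    using assms(5) by (rule continuous_on_eq) (auto simp: partial_y_eqI[OF _ assms(2)])
  ultimately show ?thesis
    unfolding C1_quadrant_def using assms(3)
    by (auto intro!: differentiableI_vector[OF assms(1)] differentiableI_vector[OF assms(2)])
qed

lemma C1_quadrant_cong:
  assumes "C1_quadrant u" and eq: "\<And>x y. x \<ge> 0 \<Longrightarrow> y \<ge> 0 \<Longrightarrow> u x y = v x y"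
  shows "C1_quadrant v"
proof (rule C1_quadrantI[where ux = "partial_x u" and uy = "partial_y u"])
  note u = C1_quadrantD[OF assms(1)]
  show "((\<lambda>s. v s y) has_vector_derivative partial_x u x y) (at x within {0..})" if "x \<ge> 0" "y \<ge> 0" for x y
    by (rule has_vector_derivative_transform[OF _ _ u(1)]) (use that eq in auto)
  show "((\<lambda>t. v x t) has_vector_derivative partial_y u x y) (at y within {0..})" if "x \<ge> 0" "y \<ge> 0" for x y
    by (rule has_vector_derivative_transform[OF _ _ u(2)]) (use that eq in auto)
  show "continuous_on ({0..} \<times> {0..}) (\<lambda>(x, y). v x y)"
    using u(3) by (rule continuous_on_eq) (use eq in auto)
qed (use C1_quadrantD[OF assms(1)] in auto)

lemma partial_x_cong:
  assumes "x \<ge> 0" "\<And>s. s \<ge> 0 \<Longrightarrow> u s y = v s y" "C1_quadrant v" "y \<ge> 0"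
  shows "partial_x u x y = partial_x v x y"
  by (rule partial_x_eqI[OF assms(1)], rule has_vector_derivative_transform[OF _ _ C1_quadrantD(1)[OF assms(3)]])
     (use assms in auto)

lemma partial_y_cong:
  assumes "y \<ge> 0" "\<And>t. t \<ge> 0 \<Longrightarrow> u x t = v x t" "C1_quadrant v" "x \<ge> 0"
  shows "partial_y u x y = partial_y v x y"
  by (rule partial_y_eqI[OF assms(1)], rule has_vector_derivative_transform[OF _ _ C1_quadrantD(2)[OF assms(3)]])
     (use assms in auto)

lemma C2_quadrantI:
  assumes u: "\<And>x y. x \<ge> 0 \<Longrightarrow> y \<ge> 0 \<Longrightarrow> ((\<lambda>s. u s y) has_vector_derivative ux x y) (at x within {0..})"
             "\<And>x y. x \<ge> 0 \<Longrightarrow> y \<ge> 0 \<Longrightarrow> ((\<lambda>t. u x t) has_vector_derivative uy x y) (at y within {0..})"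
             "continuous_on ({0..} \<times> {0..}) (\<lambda>(x, y). u x y)"
    and ux: "C1_quadrant ux" and uy: "C1_quadrant uy"
  shows "C2_quadrant u"
  unfolding C2_quadrant_def
proof (intro conjI)
  show "C1_quadrant u"
    by (rule C1_quadrantI[OF u]) (use C1_quadrantD[OF ux] C1_quadrantD[OF uy] in auto)
  show "C1_quadrant (partial_x u)" using ux
    by (rule C1_quadrant_cong) (use partial_x_eqI[OF _ u(1)] in auto)
  show "C1_quadrant (partial_y u)" using uy
    by (rule C1_quadrant_cong) (use partial_y_eqI[OF _ u(2)] in auto)
qed

lemma C2_quadrantD:
  assumes "C2_quadrant u"
  shows "C1_quadrant u" "C1_quadrant (partial_x u)" "C1_quadrant (partial_y u)"
  using assms by (auto simp: C2_quadrant_def)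

lemma C1_quadrant_diff:
  assumes "C1_quadrant u" "C1_quadrant v"
  shows "C1_quadrant (\<lambda>x y. u x y - v x y)"
    and "x \<ge> 0 \<Longrightarrow> y \<ge> 0 \<Longrightarrow> partial_x (\<lambda>x y. u x y - v x y) x y = partial_x u x y - partial_x v x y"
    and "x \<ge> 0 \<Longrightarrow> y \<ge> 0 \<Longrightarrow> partial_y (\<lambda>x y. u x y - v x y) x y = partial_y u x y - partial_y v x y"
proof -
  note D = C1_quadrantD[OF assms(1)] C1_quadrantD[OF assms(2)]
  have x: "((\<lambda>s. u s y - v s y) has_vector_derivative partial_x u x y - partial_x v x y) (at x within {0..})"
    if "x \<ge> 0" "y \<ge> 0" for x y
    by (intro has_vector_derivative_diff D that)
  have y: "((\<lambda>t. u x t - v x t) has_vector_derivative partial_y u x y - partial_y v x y) (at y within {0..})"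
    if "x \<ge> 0" "y \<ge> 0" for x y
    by (intro has_vector_derivative_diff D that)
  show "C1_quadrant (\<lambda>x y. u x y - v x y)"
    by (rule C1_quadrantI[OF x y]) (assumption | intro continuous_on_case_prod D)+
  show "x \<ge> 0 \<Longrightarrow> y \<ge> 0 \<Longrightarrow> partial_x (\<lambda>x y. u x y - v x y) x y = partial_x u x y - partial_x v x y"
    by (rule partial_x_eqI[OF _ x])
  show "x \<ge> 0 \<Longrightarrow> y \<ge> 0 \<Longrightarrow> partial_y (\<lambda>x y. u x y - v x y) x y = partial_y u x y - partial_y v x y"
    by (rule partial_y_eqI[OF _ y])
qed

lemma C1_quadrant_add:
  assumes "C1_quadrant u" "C1_quadrant v"
  shows "C1_quadrant (\<lambda>x y. u x y + v x y)"
proof -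
  note D = C1_quadrantD[OF assms(1)] C1_quadrantD[OF assms(2)]
  show ?thesis
    by (rule C1_quadrantI[where ux = "\<lambda>x y. partial_x u x y + partial_x v x y"
          and uy = "\<lambda>x y. partial_y u x y + partial_y v x y"])
       (assumption | intro continuous_on_case_prod has_vector_derivative_add D)+
qed

lemma C1_quadrant_mult:
  assumes "C1_quadrant u" "C1_quadrant v"
  shows "C1_quadrant (\<lambda>x y. u x y * v x y)"
    and "x \<ge> 0 \<Longrightarrow> y \<ge> 0 \<Longrightarrow> partial_x (\<lambda>x y. u x y * v x y) x y = u x y * partial_x v x y + partial_x u x y * v x y"
    and "x \<ge> 0 \<Longrightarrow> y \<ge> 0 \<Longrightarrow> partial_y (\<lambda>x y. u x y * v x y) x y = u x y * partial_y v x y + partial_y u x y * v x y"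
proof -
  note D = C1_quadrantD[OF assms(1)] C1_quadrantD[OF assms(2)]
  have x: "((\<lambda>s. u s y * v s y) has_vector_derivative u x y * partial_x v x y + partial_x u x y * v x y) (at x within {0..})"
    if "x \<ge> 0" "y \<ge> 0" for x y
    by (intro has_vector_derivative_mult D that)
  have y: "((\<lambda>t. u x t * v x t) has_vector_derivative u x y * partial_y v x y + partial_y u x y * v x y) (at y within {0..})"
    if "x \<ge> 0" "y \<ge> 0" for x y
    by (intro has_vector_derivative_mult D that)
  show "C1_quadrant (\<lambda>x y. u x y * v x y)"
    by (rule C1_quadrantI[OF x y]) (assumption | intro continuous_on_case_prod D)+
  show "x \<ge> 0 \<Longrightarrow> y \<ge> 0 \<Longrightarrow> partial_x (\<lambda>x y. u x y * v x y) x y = u x y * partial_x v x y + partial_x u x y * v x y"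
    by (rule partial_x_eqI[OF _ x])
  show "x \<ge> 0 \<Longrightarrow> y \<ge> 0 \<Longrightarrow> partial_y (\<lambda>x y. u x y * v x y) x y = u x y * partial_y v x y + partial_y u x y * v x y"
    by (rule partial_y_eqI[OF _ y])
qed

lemma C2_quadrant_diff:
  assumes "C2_quadrant u" "C2_quadrant v"
  shows "C2_quadrant (\<lambda>x y. u x y - v x y)"
proof -
  note C = C2_quadrantD[OF assms(1)] C2_quadrantD[OF assms(2)]
  show ?thesis
    unfolding C2_quadrant_def
    by (intro conjI C1_quadrant_diff(1) C
        C1_quadrant_cong[OF C1_quadrant_diff(1)[OF C(2) C(5)]]
        C1_quadrant_cong[OF C1_quadrant_diff(1)[OF C(3) C(6)]])
       (simp_all add: C1_quadrant_diff(2,3)[OF C(1) C(4)])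
qed

lemma C2_quadrant_mult:
  assumes "C2_quadrant u" "C2_quadrant v"
  shows "C2_quadrant (\<lambda>x y. u x y * v x y)"
proof -
  note C = C2_quadrantD[OF assms(1)] C2_quadrantD[OF assms(2)]
  have "C1_quadrant (\<lambda>x y. u x y * partial_x v x y + partial_x u x y * v x y)"
    "C1_quadrant (\<lambda>x y. u x y * partial_y v x y + partial_y u x y * v x y)"
    by (intro C1_quadrant_add C1_quadrant_mult(1) C)+
  then show ?thesis
    unfolding C2_quadrant_def
    by (intro conjI C1_quadrant_mult(1) C)
       (erule C1_quadrant_cong, simp add: C1_quadrant_mult(2,3)[OF C(1) C(4)])+
qed

lemma C2_quadrant_x:
  assumes g: "\<And>x. (g has_vector_derivative g' x) (at x)" "\<And>x. (g' has_vector_derivative g'' x) (at x)"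
    and c: "continuous_on UNIV g''"
  shows "C2_quadrant (\<lambda>x y. g x)"
proof -
  have cc: "continuous_on UNIV g" "continuous_on UNIV g'"
    using g by (meson continuous_at_imp_continuous_on has_vector_derivative_continuous)+
  have cf: "continuous_on ({0..} \<times> {0..}) (\<lambda>(x, y). h x)" if "continuous_on UNIV h" for h :: "real \<Rightarrow> complex"
    unfolding split_beta by (rule continuous_on_compose2[OF that]) (auto intro!: continuous_intros)
  have "C1_quadrant (\<lambda>x y. g' x)"
    by (intro C1_quadrantI[where ux = "\<lambda>x y. g'' x" and uy = "\<lambda>x y. 0"] cf c cc
          has_vector_derivative_at_within[OF g(2)]) (auto simp: split_beta)
  moreover have "C1_quadrant (\<lambda>x y. 0)"
    by (rule C1_quadrantI[where ux = "\<lambda>x y. 0" and uy = "\<lambda>x y. 0"]) (auto simp: split_beta)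
  ultimately show ?thesis
    by (intro C2_quadrantI[where ux = "\<lambda>x y. g' x" and uy = "\<lambda>x y. 0"] cf cc
          has_vector_derivative_at_within[OF g(1)]) (auto simp: split_beta)
qed

lemma C2_quadrant_y:
  assumes g: "\<And>x. (g has_vector_derivative g' x) (at x)" "\<And>x. (g' has_vector_derivative g'' x) (at x)"
    and c: "continuous_on UNIV g''"
  shows "C2_quadrant (\<lambda>x y. g y)"
proof -
  have cc: "continuous_on UNIV g" "continuous_on UNIV g'"
    using g by (meson continuous_at_imp_continuous_on has_vector_derivative_continuous)+
  have cf: "continuous_on ({0..} \<times> {0..}) (\<lambda>(x, y). h y)" if "continuous_on UNIV h" for h :: "real \<Rightarrow> complex"
    unfolding split_beta by (rule continuous_on_compose2[OF that]) (auto intro!: continuous_intros)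
  have "C1_quadrant (\<lambda>x y. g' y)"
    by (intro C1_quadrantI[where uy = "\<lambda>x y. g'' y" and ux = "\<lambda>x y. 0"] cf c cc
          has_vector_derivative_at_within[OF g(2)]) (auto simp: split_beta)
  moreover have "C1_quadrant (\<lambda>x y. 0)"
    by (rule C1_quadrantI[where ux = "\<lambda>x y. 0" and uy = "\<lambda>x y. 0"]) (auto simp: split_beta)
  ultimately show ?thesis
    by (intro C2_quadrantI[where uy = "\<lambda>x y. g' y" and ux = "\<lambda>x y. 0"] cf cc
          has_vector_derivative_at_within[OF g(1)]) (auto simp: split_beta)
qed

section \<open>Reduction to the Bessel operator\<close>

text \<open>
  The problem after removing the chirp: the operator is the plain Bessel operator, stated with the
  one-sided partial derivatives that also carry the regularity assumption.
\<close>
definition bessel_problem :: "real \<Rightarrow> (real \<Rightarrow> complex) \<Rightarrow> (real \<Rightarrow> real \<Rightarrow> complex) \<Rightarrow> bool" where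
  "bessel_problem \<nu> g w \<longleftrightarrow>
     C2_quadrant w \<and>
     (\<forall>x>0. \<forall>y>0. partial_x (partial_x w) x y + ((2 * \<nu> + 1) / x) *\<^sub>R partial_x w x y =
                  partial_y (partial_y w) x y + ((2 * \<nu> + 1) / y) *\<^sub>R partial_y w x y) \<and>
     (\<forall>x\<ge>0. w x 0 = g x) \<and>
     (\<forall>x\<ge>0. partial_y w x 0 = 0)"

definition chirp :: "real \<Rightarrow> real \<Rightarrow> complex" where
  "chirp c s = exp (\<i> * of_real (c * s\<^sup>2 / 2))"

lemma chirp_zero [simp]: "chirp c 0 = 1"
  by (simp add: chirp_def)

lemma chirp_nonzero [simp]: "chirp c s \<noteq> 0"
  by (simp add: chirp_def)

lemma chirp_uminus_cancel [simp]: "chirp c s * chirp (- c) s = 1" "chirp (- c) s * chirp c s = 1"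
  by (simp_all add: chirp_def mult_exp_exp)

lemma has_vector_derivative_chirp:
  "(chirp c has_vector_derivative \<i> * of_real (c * s) * chirp c s) (at s)"
proof -
  have "((\<lambda>s. exp (\<i> * of_real (c * s\<^sup>2 / 2))) has_vector_derivative
      (c * s) *\<^sub>R (\<i> * exp (\<i> * of_real (c * s\<^sup>2 / 2)))) (at s)"
  proof (rule has_vector_derivative_compose_real)
    show "((\<lambda>s. c * s\<^sup>2 / 2) has_real_derivative c * s) (at s)"
      by (auto intro!: derivative_eq_intros)
    show "((\<lambda>r. exp (\<i> * of_real r)) has_vector_derivative \<i> * exp (\<i> * of_real (c * s\<^sup>2 / 2))) (at (c * s\<^sup>2 / 2))"
      by (rule has_vector_derivative_real_field) (auto intro!: derivative_eq_intros)
  qed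
  then show ?thesis
    by (simp add: chirp_def[abs_def] scaleR_conv_of_real mult_ac)
qed

lemma C2_quadrant_chirp: "C2_quadrant (\<lambda>x y. chirp c x * chirp c y)"
proof -
  have 1: "((\<lambda>s. \<i> * of_real (c * s) * chirp c s) has_vector_derivative
      \<i> * of_real (c * s) * (\<i> * of_real (c * s) * chirp c s) + \<i> * of_real c * chirp c s) (at s)" for s
    by (rule has_vector_derivative_mult[OF _ has_vector_derivative_chirp])
       (auto intro!: has_vector_derivative_real_field derivative_eq_intros)
  have "continuous_on UNIV (chirp c)"
    by (rule has_vector_derivative_imp_continuous_on[OF has_vector_derivative_chirp])
  then have 2: "continuous_on UNIV (\<lambda>s. \<i> * of_real (c * s) * (\<i> * of_real (c * s) * chirp c s) + \<i> * of_real c * chirp c s)"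
    by (intro continuous_intros)
  show ?thesis
    by (rule C2_quadrant_mult[OF C2_quadrant_x[OF has_vector_derivative_chirp 1 2]
          C2_quadrant_y[OF has_vector_derivative_chirp 1 2]])
qed

text \<open>
  The conjugation identity. The first-order terms produced by the chirp cancel the term
  \<open>- 2 \<i> c x g'\<close>, and the zeroth-order ones cancel because \<open>\<i>\<^sup>2 = - 1\<close> and \<open>(\<alpha>/x) (\<i> c x) = \<i> c \<alpha>\<close>,
  where \<open>\<alpha> = 2\<nu> + 1\<close>. The constant \<open>A\<close> stands for the chirp in the variable that is held fixed.
\<close>
lemma canonical_bessel_op_chirp:
  fixes h h' h'' :: "real \<Rightarrow> complex" and m :: "real^2^2"
  defines "c \<equiv> m $ 2 $ 2 / m $ 1 $ 2"
  assumes x: "x > 0"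
    and h: "\<And>t. t > 0 \<Longrightarrow> (h has_vector_derivative h' t) (at t)"
           "\<And>t. t > 0 \<Longrightarrow> (h' has_vector_derivative h'' t) (at t)"
  shows "canonical_bessel_op \<nu> m (\<lambda>s. A * chirp c s * h s) x =
           A * chirp c x * (h'' x + ((2 * \<nu> + 1) / x) *\<^sub>R h' x)"
proof -
  define g where "g = (\<lambda>s. A * chirp c s * h s)"
  define g' where "g' = (\<lambda>s. A * chirp c s * (h' s + \<i> * of_real (c * s) * h s))"
  have A: "((\<lambda>s. A * chirp c s) has_vector_derivative A * (\<i> * of_real (c * s) * chirp c s)) (at s)" for s
    by (rule bounded_linear.has_vector_derivative[OF bounded_linear_mult_right has_vector_derivative_chirp])
  have g: "(g has_vector_derivative g' t) (at t)" if "t > 0" for t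
    unfolding g_def g'_def
    by (rule has_vector_derivative_eq_rhs[OF has_vector_derivative_mult[OF A h(1)[OF that]]])
       (simp add: algebra_simps)
  have g': "(g' has_vector_derivative A * chirp c t * (h'' t + (\<i> * of_real (c * t) * h' t + \<i> * of_real c * h t)) +
        A * (\<i> * of_real (c * t) * chirp c t) * (h' t + \<i> * of_real (c * t) * h t)) (at t)" if "t > 0" for t
    unfolding g'_def
    by (intro has_vector_derivative_mult[OF A] has_vector_derivative_add h that has_vector_derivative_mult
           has_vector_derivative_real_field)
       (auto intro!: derivative_eq_intros)
  have v: "vector_derivative g (at t) = g' t" if "t > 0" for t
    using g[OF that] by (rule vector_derivative_at)
  have "((\<lambda>t. vector_derivative g (at t)) has_vector_derivative A * chirp c x * (h'' x + (\<i> * of_real (c * x) * h' x + \<i> * of_real c * h x)) +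
        A * (\<i> * of_real (c * x) * chirp c x) * (h' x + \<i> * of_real (c * x) * h x)) (at x)"
    by (rule has_vector_derivative_transform_within_open[OF g'[OF x], of "{0<..}"]) (use x v in auto)
  then have v2: "vector_derivative (\<lambda>t. vector_derivative g (at t)) (at x) =
        A * chirp c x * (h'' x + (\<i> * of_real (c * x) * h' x + \<i> * of_real c * h x)) +
        A * (\<i> * of_real (c * x) * chirp c x) * (h' x + \<i> * of_real (c * x) * h x)"
    by (rule vector_derivative_at)
  have c2: "(m $ 2 $ 2)\<^sup>2 / (m $ 1 $ 2)\<^sup>2 = c\<^sup>2"
    by (simp add: c_def power_divide)
  define q where "q = complex_of_real ((2 * \<nu> + 1) / x)"
  have q: "q * of_real x = of_real (2 * \<nu> + 1)" using x by (simp add: q_def)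
  have "canonical_bessel_op \<nu> m g x =
        A * chirp c x * (h'' x + (\<i> * of_real (c * x) * h' x + \<i> * of_real c * h x)) +
        A * (\<i> * of_real (c * x) * chirp c x) * (h' x + \<i> * of_real (c * x) * h x)
        + (q - 2 * \<i> * of_real c * of_real x) * g' x
        - (of_real (c\<^sup>2 * x\<^sup>2) + 2 * \<i> * of_real (\<nu> + 1) * of_real c) * g x"
    unfolding canonical_bessel_op_def Let_def v2 v[OF x] q_def c2 c_def[symmetric] ..
  also have "\<dots> = A * chirp c x * (h'' x + q * h' x
      + \<i> * of_real c * h x * (q * of_real x - of_real (2 * \<nu> + 1)) + (1 + \<i> * \<i>) * (of_real c * of_real x)^2 * (-1) * h x)"
    unfolding g'_def g_def by (simp add: algebra_simps power2_eq_square)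
  also have "\<dots> = A * chirp c x * (h'' x + ((2 * \<nu> + 1) / x) *\<^sub>R h' x)"
    unfolding q by (simp add: q_def scaleR_conv_of_real)
  finally show ?thesis by (simp add: g_def)
qed

text \<open>
  The derivative of the chirp vanishes at the origin, so multiplication by it respects the Neumann
  condition at \<open>y = 0\<close>.
\<close>
lemma chirp_quadrant:
  assumes w: "C2_quadrant w"
  shows "C2_quadrant (\<lambda>x y. chirp c x * chirp c y * w x y)"
    and "x \<ge> 0 \<Longrightarrow> partial_y (\<lambda>x y. chirp c x * chirp c y * w x y) x 0 = chirp c x * partial_y w x 0"
proof -
  show "C2_quadrant (\<lambda>x y. chirp c x * chirp c y * w x y)"
    by (rule C2_quadrant_mult[OF C2_quadrant_chirp w])
  have "partial_y (\<lambda>x y. chirp c x * chirp c y) x 0 = 0" if "x \<ge> 0"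
    by (rule partial_y_eqI)
       (use bounded_linear.has_vector_derivative[OF bounded_linear_mult_right has_vector_derivative_chirp[of c 0], of "chirp c x"]
        in \<open>auto intro: has_vector_derivative_at_within\<close>)
  then show "x \<ge> 0 \<Longrightarrow> partial_y (\<lambda>x y. chirp c x * chirp c y * w x y) x 0 = chirp c x * partial_y w x 0"
    using C1_quadrant_mult(3)[OF C2_quadrantD(1)[OF C2_quadrant_chirp] C2_quadrantD(1)[OF w], of x 0 c] by simp
qed

lemma canonical_bessel_op_quadrant:
  fixes m :: "real^2^2"
  defines "c \<equiv> m $ 2 $ 2 / m $ 1 $ 2"
  assumes w: "C2_quadrant w" and x: "x > 0" and y: "y > 0"
  shows "canonical_bessel_op \<nu> m (\<lambda>s. chirp c s * chirp c y * w s y) x =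
           chirp c x * chirp c y * (partial_x (partial_x w) x y + ((2 * \<nu> + 1) / x) *\<^sub>R partial_x w x y)"
    and "canonical_bessel_op \<nu> m (\<lambda>t. chirp c x * chirp c t * w x t) y =
           chirp c x * chirp c y * (partial_y (partial_y w) x y + ((2 * \<nu> + 1) / y) *\<^sub>R partial_y w x y)"
proof -
  note D = C1_quadrantD(1,2)[OF C2_quadrantD(1)[OF w]] C1_quadrantD(1)[OF C2_quadrantD(2)[OF w]]
    C1_quadrantD(2)[OF C2_quadrantD(3)[OF w]]
  have "canonical_bessel_op \<nu> m (\<lambda>s. chirp c y * chirp c s * w s y) x =
      chirp c y * chirp c x * (partial_x (partial_x w) x y + ((2 * \<nu> + 1) / x) *\<^sub>R partial_x w x y)"
    unfolding c_def
    by (rule canonical_bessel_op_chirp[OF x])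
       (use D y in \<open>auto simp: at_within_Ici_interior[symmetric]\<close>)
  then show "canonical_bessel_op \<nu> m (\<lambda>s. chirp c s * chirp c y * w s y) x =
           chirp c x * chirp c y * (partial_x (partial_x w) x y + ((2 * \<nu> + 1) / x) *\<^sub>R partial_x w x y)"
    by (simp only: mult.commute[of "chirp c y"])
  show "canonical_bessel_op \<nu> m (\<lambda>t. chirp c x * chirp c t * w x t) y =
           chirp c x * chirp c y * (partial_y (partial_y w) x y + ((2 * \<nu> + 1) / y) *\<^sub>R partial_y w x y)"
    unfolding c_def
    by (rule canonical_bessel_op_chirp[OF y])
       (use D x in \<open>auto simp: at_within_Ici_interior[symmetric]\<close>)
qed

lemma canonical_bessel_problem_of_bessel:
  fixes m :: "real^2^2"
  defines "c \<equiv> m $ 2 $ 2 / m $ 1 $ 2"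
  assumes w: "bessel_problem \<nu> g w"
  shows "canonical_bessel_problem \<nu> m (\<lambda>x. chirp c x * g x) (\<lambda>x y. chirp c x * chirp c y * w x y)"
proof -
  have C: "C2_quadrant w" using w by (simp add: bessel_problem_def)
  show ?thesis
    unfolding canonical_bessel_problem_def
    using w chirp_quadrant(1)[OF C, of c] chirp_quadrant(2)[OF C, of _ c]
    by (auto simp: bessel_problem_def canonical_bessel_op_quadrant[OF C, of _ _ \<nu> m, folded c_def])
qed

text \<open>
  The inverse of a chirp is the chirp with the opposite parameter, so every solution of the canonical
  problem is a chirp times some \<open>w\<close> to which the conjugation identity applies.
\<close>
lemma bessel_problem_of_canonical:
  fixes m :: "real^2^2"
  defines "c \<equiv> m $ 2 $ 2 / m $ 1 $ 2"
  assumes v: "canonical_bessel_problem \<nu> m f v"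
  shows "bessel_problem \<nu> (\<lambda>x. chirp (- c) x * f x) (\<lambda>x y. chirp (- c) x * chirp (- c) y * v x y)"
proof -
  define w where "w = (\<lambda>x y. chirp (- c) x * chirp (- c) y * v x y)"
  have C: "C2_quadrant v" using v by (simp add: canonical_bessel_problem_def)
  have Cw: "C2_quadrant w" unfolding w_def by (rule chirp_quadrant[OF C])
  have "chirp c x * chirp c y * w x y = (chirp c x * chirp (- c) x) * (chirp c y * chirp (- c) y) * v x y" for x y
    unfolding w_def by (simp only: mult_ac)
  then have vw: "v x y = chirp c x * chirp c y * w x y" for x y
    by simp
  have "partial_x (partial_x w) x y + ((2 * \<nu> + 1) / x) *\<^sub>R partial_x w x y =
        partial_y (partial_y w) x y + ((2 * \<nu> + 1) / y) *\<^sub>R partial_y w x y" if "x > 0" "y > 0" for x y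
  proof -
    have "canonical_bessel_op \<nu> m (\<lambda>s. v s y) x = canonical_bessel_op \<nu> m (\<lambda>t. v x t) y"
      using v that by (simp add: canonical_bessel_problem_def)
    then show ?thesis
      unfolding vw canonical_bessel_op_quadrant[OF Cw that, of \<nu> m, folded c_def] by simp
  qed
  moreover have "w x 0 = chirp (- c) x * f x" "partial_y w x 0 = 0" if "x \<ge> 0" for x
    using chirp_quadrant(2)[OF C that, of "- c"] v that by (auto simp: w_def canonical_bessel_problem_def)
  ultimately have "bessel_problem \<nu> (\<lambda>x. chirp (- c) x * f x) w"
    unfolding bessel_problem_def using Cw by simp
  then show ?thesis by (simp only: w_def)
qed

section \<open>The normalised angular weight\<close>

definition parameter_integral ::
    "(real \<Rightarrow> real) \<Rightarrow> real \<Rightarrow> real \<Rightarrow> (real \<Rightarrow> real \<Rightarrow> real \<Rightarrow> complex) \<Rightarrow> real \<Rightarrow> real \<Rightarrow> complex" where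
  "parameter_integral k a b f x y = integral {a..b} (\<lambda>t. k t *\<^sub>R f x y t)"

text \<open>
  One differentiation under the integral sign in each variable. The existence proof applies it three
  times: to the integrand and to its two first partial derivatives.
\<close>
lemma C1_quadrant_parameter_integral:
  assumes k: "k absolutely_integrable_on {a..b}"
    and fx: "\<And>x y t. ((\<lambda>x. f x y t) has_vector_derivative fx x y t) (at x)"
    and fy: "\<And>x y t. ((\<lambda>y. f x y t) has_vector_derivative fy x y t) (at y)"
    and cf: "continuous_on UNIV (\<lambda>(x, y, t). f x y t)"
    and cfx: "continuous_on UNIV (\<lambda>(x, y, t). fx x y t)"
    and cfy: "continuous_on UNIV (\<lambda>(x, y, t). fy x y t)"
  shows "C1_quadrant (parameter_integral k a b f)"
    and "x \<ge> 0 \<Longrightarrow> partial_x (parameter_integral k a b f) x y = parameter_integral k a b fx x y"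
    and "y \<ge> 0 \<Longrightarrow> partial_y (parameter_integral k a b f) x y = parameter_integral k a b fy x y"
    and "((\<lambda>s. parameter_integral k a b f s y) has_vector_derivative parameter_integral k a b fx x y) (at x within {0..})"
    and "((\<lambda>t. parameter_integral k a b f x t) has_vector_derivative parameter_integral k a b fy x y) (at y within {0..})"
    and "continuous_on S (\<lambda>(x, y). parameter_integral k a b f x y)"
proof -
  have comp: "continuous_on T (\<lambda>z. g (p z) (q z) (r z))"
    if "continuous_on UNIV (\<lambda>(x, y, t). g x y t)" "continuous_on T p" "continuous_on T q" "continuous_on T r"
    for g :: "real \<Rightarrow> real \<Rightarrow> real \<Rightarrow> complex" and T :: "'z::topological_space set" and p q r
    using continuous_on_compose2[OF that(1), of T "\<lambda>z. (p z, q z, r z)"] that(2-) by (simp add: continuous_on_Pair)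
  have cont: "continuous_on S (\<lambda>(x, y). parameter_integral k a b g x y)"
    if "continuous_on UNIV (\<lambda>(x, y, t). g x y t)" for g S
    unfolding parameter_integral_def split_beta
    by (rule continuous_on_weighted_integral[OF _ k], unfold split_beta, rule comp[OF that]; intro continuous_intros)
  have x: "((\<lambda>s. parameter_integral k a b f s y) has_vector_derivative parameter_integral k a b fx x y) (at x)" for x y
    unfolding parameter_integral_def
    by (rule has_vector_derivative_weighted_integral[OF fx _ _ k];
        (unfold split_beta)?, (rule comp[OF cf] comp[OF cfx]); intro continuous_intros)
  have y: "((\<lambda>t. parameter_integral k a b f x t) has_vector_derivative parameter_integral k a b fy x y) (at y)" for x y
    unfolding parameter_integral_def
    by (rule has_vector_derivative_weighted_integral[OF fy _ _ k];
        (unfold split_beta)?, (rule comp[OF cf] comp[OF cfy]); intro continuous_intros)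
  show xw: "((\<lambda>s. parameter_integral k a b f s y) has_vector_derivative parameter_integral k a b fx x y) (at x within {0..})" for x y
    by (rule has_vector_derivative_at_within[OF x])
  show yw: "((\<lambda>t. parameter_integral k a b f x t) has_vector_derivative parameter_integral k a b fy x y) (at y within {0..})" for x y
    by (rule has_vector_derivative_at_within[OF y])
  show "C1_quadrant (parameter_integral k a b f)"
    by (rule C1_quadrantI[OF xw yw cont[OF cf] cont[OF cfx] cont[OF cfy]])
  show "x \<ge> 0 \<Longrightarrow> partial_x (parameter_integral k a b f) x y = parameter_integral k a b fx x y"
    by (rule partial_x_eqI) (assumption | rule xw)+
  show "y \<ge> 0 \<Longrightarrow> partial_y (parameter_integral k a b f) x y = parameter_integral k a b fy x y"
    by (rule partial_y_eqI) (assumption | rule yw)+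
  show "continuous_on S (\<lambda>(x, y). parameter_integral k a b f x y)"
    by (rule cont[OF cf])
qed

text \<open>
  Legendre's duplication formula, in the shape in which it appears when the weight is normalised.
\<close>
lemma Beta_half_duplication:
  fixes a :: real
  assumes "a > 0"
  shows "2 powr (2 * a - 1) * Beta a a = sqrt pi * Gamma a / Gamma (a + 1 / 2)"
proof -
  have "a \<notin> \<int>\<^sub>\<le>\<^sub>0" "a + 1 / 2 \<notin> \<int>\<^sub>\<le>\<^sub>0"
    using assms nonpos_Ints_nonpos[of a] nonpos_Ints_nonpos[of "a + 1/2"] by auto
  then have ni: "complex_of_real a \<notin> \<int>\<^sub>\<le>\<^sub>0" "complex_of_real (a + 1 / 2) \<notin> \<int>\<^sub>\<le>\<^sub>0"
    by (simp_all only: of_real_in_nonpos_Ints_iff not_False_eq_True)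
  have "complex_of_real (Gamma a * Gamma (a + 1/2)) =
      complex_of_real (exp ((1 - 2 * a) * ln 2) * sqrt pi * Gamma (2 * a))"
    using Gamma_legendre_duplication[of "complex_of_real a", OF ni(1)] ni(2)
    by (simp add: Gamma_complex_of_real[symmetric] exp_of_real[symmetric])
  then have dup: "Gamma a * Gamma (a + 1/2) = 2 powr (1 - 2 * a) * sqrt pi * Gamma (2 * a)"
    unfolding of_real_eq_iff by (simp add: powr_def)
  have pos: "Gamma a > 0" "Gamma (a + 1/2) > 0" "Gamma (2 * a) > 0" using assms by (auto intro: Gamma_real_pos)
  have "2 powr (2 * a - 1) * (Gamma a * Gamma (a + 1/2)) =
      (2 powr (2 * a - 1) * 2 powr (1 - 2 * a)) * (sqrt pi * Gamma (2 * a))"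
    unfolding dup by (simp only: mult_ac)
  also have "\<dots> = sqrt pi * Gamma (2 * a)" by (simp flip: powr_add)
  finally have "2 powr (2 * a - 1) * (Gamma a * Gamma a) * Gamma (a + 1/2) = sqrt pi * Gamma a * Gamma (2 * a)"
    by (simp only: mult_ac)
  then show ?thesis using pos
    unfolding Beta_def mult_2[symmetric] times_divide_eq_right by (subst frac_eq_eq) auto
qed

text \<open>
  The substitution \<open>t = (1 - cos \<theta>) / 2\<close> turns the integral into the Beta integral with both
  parameters \<open>\<nu> + 1/2\<close>, because \<open>t (1 - t) = (sin \<theta> / 2)\<^sup>2\<close> and \<open>dt = (sin \<theta> / 2) d\<theta>\<close>. The change of
  variables is made on the open interval, away from the singularities at the ends.
\<close>
lemma sin_powr_absolutely_integrable_and_integral: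
  fixes \<nu> :: real
  assumes "\<nu> > - 1 / 2"
  shows "(\<lambda>\<theta>. sin \<theta> powr (2 * \<nu>)) absolutely_integrable_on {0..pi}"
    and "integral {0..pi} (\<lambda>\<theta>. sin \<theta> powr (2 * \<nu>)) = sqrt pi * Gamma (\<nu> + 1 / 2) / Gamma (\<nu> + 1)"
proof -
  define a where "a = \<nu> + 1 / 2"
  have a: "a > 0" using assms by (simp add: a_def)
  define f where "f = (\<lambda>t::real. t powr (a - 1) * (1 - t) powr (a - 1))"
  define g where "g = (\<lambda>\<theta>::real. (1 - cos \<theta>) / 2)"
  have "(f has_integral Beta a a) {0<..<1}"
    using has_integral_Beta_real[OF a a] by (simp add: f_def has_integral_Icc_iff_Ioo)
  then have f: "f absolutely_integrable_on {0<..<1}" "integral {0<..<1} f = Beta a a"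
    by (auto simp: has_integral_iff f_def intro!: nonnegative_absolutely_integrable_1)
  have img: "g ` {0<..<pi} = {0<..<1}"
  proof (intro equalityI subsetI)
    fix t assume "t \<in> g ` {0<..<pi}"
    then obtain \<theta> where \<theta>: "0 < \<theta>" "\<theta> < pi" "t = g \<theta>" by auto
    then show "t \<in> {0<..<1}"
      using cos_monotone_0_pi[of 0 \<theta>] cos_monotone_0_pi[of \<theta> pi] by (auto simp: g_def)
  next
    fix t :: real assume t: "t \<in> {0<..<1}"
    then have "t = g (arccos (1 - 2 * t))" by (simp add: g_def cos_arccos)
    moreover have "arccos (1 - 2 * t) \<in> {0<..<pi}" using arccos_lt_bounded[of "1 - 2 * t"] t by auto
    ultimately show "t \<in> g ` {0<..<pi}" by blast
  qed
  have inj: "inj_on g {0<..<pi}"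
    by (rule inj_onI) (auto simp: g_def intro: cos_inj_pi)
  have der: "(g has_field_derivative sin \<theta> / 2) (at \<theta> within {0<..<pi})" for \<theta>
    unfolding g_def by (auto intro!: derivative_eq_intros)
  have eq: "\<bar>sin \<theta> / 2\<bar> * f (g \<theta>) = 2 powr (- 2 * \<nu>) * sin \<theta> powr (2 * \<nu>)" if "\<theta> \<in> {0<..<pi}" for \<theta>
  proof -
    have s: "sin \<theta> > 0" using that by (auto intro: sin_gt_zero)
    have "g \<theta> * (1 - g \<theta>) = (sin \<theta> / 2) ^ 2"
      unfolding power_divide sin_squared_eq by (simp add: g_def field_simps power2_eq_square)
    moreover have "g \<theta> \<ge> 0" "1 - g \<theta> \<ge> 0" by (simp_all add: g_def)
    ultimately have "f (g \<theta>) = ((sin \<theta> / 2) ^ 2) powr (a - 1)"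
      by (simp add: f_def flip: powr_mult)
    also have "\<dots> = (sin \<theta> / 2) powr (2 * \<nu> - 1)"
      using s by (simp add: powr_powr a_def algebra_simps flip: powr_numeral)
    finally have "\<bar>sin \<theta> / 2\<bar> * f (g \<theta>) = (sin \<theta> / 2) powr (2 * \<nu>)"
      using s by (simp add: powr_diff)
    also have "\<dots> = 2 powr (- 2 * \<nu>) * sin \<theta> powr (2 * \<nu>)"
      using s by (simp add: powr_divide powr_minus field_simps)
    finally show ?thesis .
  qed
  have "(\<lambda>\<theta>. \<bar>sin \<theta> / 2\<bar> * f (g \<theta>)) absolutely_integrable_on {0<..<pi} \<and>
      integral {0<..<pi} (\<lambda>\<theta>. \<bar>sin \<theta> / 2\<bar> * f (g \<theta>)) = Beta a a"
    by (subst has_absolute_integral_change_of_variables_1'[OF _ der inj]) (use f img in auto)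
  then have "((\<lambda>\<theta>. \<bar>sin \<theta> / 2\<bar> * f (g \<theta>)) has_integral Beta a a) {0<..<pi}"
    using set_lebesgue_integral_eq_integral(1) by (auto simp: has_integral_iff)
  then have "((\<lambda>\<theta>. 2 powr (- 2 * \<nu>) * sin \<theta> powr (2 * \<nu>)) has_integral Beta a a) {0<..<pi}"
    by (rule has_integral_eq[rotated]) (rule eq)
  then have "((\<lambda>\<theta>. 2 powr (2 * \<nu>) * (2 powr (- 2 * \<nu>) * sin \<theta> powr (2 * \<nu>))) has_integral 2 powr (2 * \<nu>) * Beta a a) {0<..<pi}"
    by (rule has_integral_mult_right)
  then have "((\<lambda>\<theta>. sin \<theta> powr (2 * \<nu>)) has_integral 2 powr (2 * a - 1) * Beta a a) {0..pi}"
    by (simp add: has_integral_Icc_iff_Ioo powr_minus a_def algebra_simps)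
  then have "((\<lambda>\<theta>. sin \<theta> powr (2 * \<nu>)) has_integral sqrt pi * Gamma (\<nu> + 1 / 2) / Gamma (\<nu> + 1)) {0..pi}"
    unfolding Beta_half_duplication[OF a] by (simp add: a_def add.assoc)
  then show "(\<lambda>\<theta>. sin \<theta> powr (2 * \<nu>)) absolutely_integrable_on {0..pi}"
    "integral {0..pi} (\<lambda>\<theta>. sin \<theta> powr (2 * \<nu>)) = sqrt pi * Gamma (\<nu> + 1 / 2) / Gamma (\<nu> + 1)"
    by (auto simp: has_integral_iff intro!: nonnegative_absolutely_integrable_1)
qed

section \<open>Existence: the generalized translation solves the Bessel problem\<close>

definition angular_kernel :: "real \<Rightarrow> real \<Rightarrow> real" where
  "angular_kernel \<nu> \<theta> = Gamma (\<nu> + 1) / (sqrt pi * Gamma (\<nu> + 1 / 2)) * sin \<theta> powr (2 * \<nu>)"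

text \<open>
  The squared third side of a triangle with sides \<open>x\<close>, \<open>y\<close> and enclosed angle \<open>\<theta>\<close>.
\<close>
definition chord_square :: "real \<Rightarrow> real \<Rightarrow> real \<Rightarrow> real" where
  "chord_square x y \<theta> = x\<^sup>2 + y\<^sup>2 - 2 * x * y * cos \<theta>"

lemma chord_square_nonneg: "chord_square x y \<theta> \<ge> 0"
proof -
  have "chord_square x y \<theta> = (x - y * cos \<theta>)\<^sup>2 + (y * sin \<theta>)\<^sup>2"
    unfolding power_mult_distrib sin_squared_eq by (simp add: chord_square_def power2_eq_square algebra_simps)
  then show ?thesis by simp
qed

lemma angular_kernel_absolutely_integrable:
  assumes "\<nu> > - 1 / 2"
  shows "angular_kernel \<nu> absolutely_integrable_on {0..pi}"
proof -
  have "(\<lambda>\<theta>. (Gamma (\<nu> + 1) / (sqrt pi * Gamma (\<nu> + 1 / 2))) *\<^sub>R (sin \<theta> powr (2 * \<nu>))) absolutely_integrable_on {0..pi}"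
    by (rule absolutely_integrable_scaleR_left[OF sin_powr_absolutely_integrable_and_integral(1)[OF assms]])
  then show ?thesis by (simp add: angular_kernel_def[abs_def])
qed

lemma integral_angular_kernel:
  assumes "\<nu> > - 1 / 2"
  shows "integral {0..pi} (angular_kernel \<nu>) = 1"
proof -
  have "Gamma (\<nu> + 1) > 0" "Gamma (\<nu> + 1 / 2) > 0" using assms by (auto intro: Gamma_real_pos)
  then show ?thesis
    using sin_powr_absolutely_integrable_and_integral(2)[OF assms] by (simp add: angular_kernel_def[abs_def])
qed

lemma has_vector_derivative_chord_square:
  assumes "\<And>r. (G has_vector_derivative G' r) (at r)"
  shows "((\<lambda>x. G (chord_square x y \<theta>)) has_vector_derivative
            (2 * (x - y * cos \<theta>)) *\<^sub>R G' (chord_square x y \<theta>)) (at x)"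
    and "((\<lambda>y. G (chord_square x y \<theta>)) has_vector_derivative
            (2 * (y - x * cos \<theta>)) *\<^sub>R G' (chord_square x y \<theta>)) (at y)"
    and "((\<lambda>\<theta>. G (chord_square x y \<theta>)) has_vector_derivative
            (2 * x * y * sin \<theta>) *\<^sub>R G' (chord_square x y \<theta>)) (at \<theta>)"
  by (rule has_vector_derivative_compose_real[OF _ assms];
      auto simp: chord_square_def intro!: derivative_eq_intros)+

text \<open>
  The integrand is the \<open>\<theta>\<close>-derivative of \<open>2 C (sin \<theta>)\<^bsup>2\<nu>+1\<^esup> G1(chord_square x y \<theta>)\<close>, with \<open>C\<close> the
  normalising constant of the weight. The exponent \<open>2\<nu> + 1\<close> is positive, so this primitive is continuous
  up to the ends of the interval and is 0 there. For \<open>x, y > 0\<close> this amounts to the differential equation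
  for the translation; for \<open>y = 0\<close> it contains that \<open>cos \<theta>\<close> has mean 0 with respect to the weight.
\<close>
lemma integral_angular_kernel_identity:
  fixes G1 G2 :: "real \<Rightarrow> complex"
  assumes nu: "\<nu> > - 1 / 2" and G: "\<And>r. (G1 has_vector_derivative G2 r) (at r)"
  shows "((\<lambda>\<theta>. angular_kernel \<nu> \<theta> *\<^sub>R
            ((4 * x * y * (sin \<theta>)\<^sup>2) *\<^sub>R G2 (chord_square x y \<theta>)
             + (2 * (2 * \<nu> + 1) * cos \<theta>) *\<^sub>R G1 (chord_square x y \<theta>))) has_integral 0) {0..pi}"
proof -
  define C where "C = Gamma (\<nu> + 1) / (sqrt pi * Gamma (\<nu> + 1 / 2))"
  define F where "F = (\<lambda>\<theta>. (C * (2 * sin \<theta> powr (2 * \<nu> + 1))) *\<^sub>R G1 (chord_square x y \<theta>))"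
  define I where "I = (\<lambda>\<theta>. angular_kernel \<nu> \<theta> *\<^sub>R
            ((4 * x * y * (sin \<theta>)\<^sup>2) *\<^sub>R G2 (chord_square x y \<theta>)
             + (2 * (2 * \<nu> + 1) * cos \<theta>) *\<^sub>R G1 (chord_square x y \<theta>)))"
  have "continuous_on {0..pi} (\<lambda>\<theta>. sin \<theta> powr (2 * \<nu> + 1))"
    by (rule continuous_on_powr') (use nu in \<open>auto intro!: continuous_intros sin_ge_zero\<close>)
  moreover have "continuous_on {0..pi} (\<lambda>\<theta>. G1 (chord_square x y \<theta>))"
    by (rule has_vector_derivative_imp_continuous_on[OF has_vector_derivative_chord_square(3)[OF G]])
  ultimately have cont: "continuous_on {0..pi} F"
    unfolding F_def by (intro continuous_on_scaleR continuous_on_mult continuous_on_const)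
  have der: "(F has_vector_derivative I \<theta>) (at \<theta>)" if "\<theta> \<in> {0<..<pi}" for \<theta>
  proof -
    have s: "sin \<theta> > 0" using that by (auto intro: sin_gt_zero)
    have "((\<lambda>\<theta>. sin \<theta> powr (2 * \<nu> + 1)) has_real_derivative (2 * \<nu> + 1) * sin \<theta> powr (2 * \<nu>) * cos \<theta>) (at \<theta>)"
      by (rule DERIV_cong[OF DERIV_powr[OF DERIV_sin s DERIV_const]]) (use s in \<open>simp add: powr_add\<close>)
    then have d: "((\<lambda>\<theta>. C * (2 * sin \<theta> powr (2 * \<nu> + 1))) has_real_derivative
        C * (2 * ((2 * \<nu> + 1) * sin \<theta> powr (2 * \<nu>) * cos \<theta>))) (at \<theta>)"
      by (intro DERIV_cmult)
    have "I \<theta> = (C * (2 * sin \<theta> powr (2 * \<nu> + 1))) *\<^sub>R ((2 * x * y * sin \<theta>) *\<^sub>R G2 (chord_square x y \<theta>))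
       + (C * (2 * ((2 * \<nu> + 1) * sin \<theta> powr (2 * \<nu>) * cos \<theta>))) *\<^sub>R G1 (chord_square x y \<theta>)"
      using s by (simp add: I_def angular_kernel_def C_def[symmetric] powr_add scaleR_add_right power2_eq_square mult_ac)
    then show ?thesis
      unfolding F_def using has_vector_derivative_scaleR[OF d has_vector_derivative_chord_square(3)[OF G]] by simp
  qed
  have "(I has_integral F pi - F 0) {0..pi}"
    by (rule fundamental_theorem_of_calculus_interior[OF _ cont der]) auto
  then show ?thesis by (simp add: F_def I_def)
qed

text \<open>
  In the difference of the two Bessel operators the terms \<open>2 G1\<close> cancel, and what remains is
  \<open>(x\<^sup>2 - y\<^sup>2) / (x y)\<close> times the integrand of \<open>integral_angular_kernel_identity\<close>.
\<close>
lemma bessel_problem_angular_integral: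
  fixes G G1 G2 :: "real \<Rightarrow> complex"
  assumes nu: "\<nu> > - 1 / 2"
    and G: "\<And>r. (G has_vector_derivative G1 r) (at r)" "\<And>r. (G1 has_vector_derivative G2 r) (at r)"
    and G2: "continuous_on UNIV G2"
  shows "bessel_problem \<nu> (\<lambda>x. G (x\<^sup>2))
           (parameter_integral (angular_kernel \<nu>) 0 pi (\<lambda>x y \<theta>. G (chord_square x y \<theta>)))"
proof -
  define k where "k = angular_kernel \<nu>"
  have k: "k absolutely_integrable_on {0..pi}"
    unfolding k_def by (rule angular_kernel_absolutely_integrable[OF nu])
  define f where "f = (\<lambda>x y \<theta>. G (chord_square x y \<theta>))"
  define fx where "fx = (\<lambda>x y \<theta>. (2 * (x - y * cos \<theta>)) *\<^sub>R G1 (chord_square x y \<theta>))"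
  define fy where "fy = (\<lambda>x y \<theta>. (2 * (y - x * cos \<theta>)) *\<^sub>R G1 (chord_square x y \<theta>))"
  define fxx where "fxx = (\<lambda>x y \<theta>. (2 * (x - y * cos \<theta>)) *\<^sub>R (2 * (x - y * cos \<theta>)) *\<^sub>R G2 (chord_square x y \<theta>)
      + 2 *\<^sub>R G1 (chord_square x y \<theta>))"
  define fyy where "fyy = (\<lambda>x y \<theta>. (2 * (y - x * cos \<theta>)) *\<^sub>R (2 * (y - x * cos \<theta>)) *\<^sub>R G2 (chord_square x y \<theta>)
      + 2 *\<^sub>R G1 (chord_square x y \<theta>))"
  define fxy where "fxy = (\<lambda>x y \<theta>. (2 * (x - y * cos \<theta>)) *\<^sub>R (2 * (y - x * cos \<theta>)) *\<^sub>R G2 (chord_square x y \<theta>)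
      + (- 2 * cos \<theta>) *\<^sub>R G1 (chord_square x y \<theta>))"
  define fyx where "fyx = (\<lambda>x y \<theta>. (2 * (y - x * cos \<theta>)) *\<^sub>R (2 * (x - y * cos \<theta>)) *\<^sub>R G2 (chord_square x y \<theta>)
      + (- 2 * cos \<theta>) *\<^sub>R G1 (chord_square x y \<theta>))"
  have cG: "continuous_on UNIV (\<lambda>z. H (chord_square (fst z) (fst (snd z)) (snd (snd z))))"
    if "continuous_on UNIV H" for H :: "real \<Rightarrow> complex"
    by (rule continuous_on_compose2[OF that]) (auto simp: chord_square_def intro!: continuous_intros)
  note cG012 = cG[OF has_vector_derivative_imp_continuous_on[OF G(1)]]
    cG[OF has_vector_derivative_imp_continuous_on[OF G(2)]] cG[OF G2]
  have cont: "continuous_on UNIV (\<lambda>(x, y, \<theta>). f x y \<theta>)"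
    "continuous_on UNIV (\<lambda>(x, y, \<theta>). fx x y \<theta>)" "continuous_on UNIV (\<lambda>(x, y, \<theta>). fy x y \<theta>)"
    "continuous_on UNIV (\<lambda>(x, y, \<theta>). fxx x y \<theta>)" "continuous_on UNIV (\<lambda>(x, y, \<theta>). fyy x y \<theta>)"
    "continuous_on UNIV (\<lambda>(x, y, \<theta>). fxy x y \<theta>)" "continuous_on UNIV (\<lambda>(x, y, \<theta>). fyx x y \<theta>)"
    unfolding f_def fx_def fy_def fxx_def fyy_def fxy_def fyx_def split_beta
    by (intro cG012 continuous_on_add continuous_on_scaleR continuous_on_mult continuous_on_diff continuous_on_const
          continuous_on_cos continuous_on_fst continuous_on_snd continuous_on_id)+
  have der: "((\<lambda>x. f x y \<theta>) has_vector_derivative fx x y \<theta>) (at x)"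
    "((\<lambda>y. f x y \<theta>) has_vector_derivative fy x y \<theta>) (at y)" for x y \<theta>
    unfolding f_def fx_def fy_def by (rule has_vector_derivative_chord_square[OF G(1)])+
  note chord_x = has_vector_derivative_scaleR[OF _ has_vector_derivative_chord_square(1)[OF G(2)]]
    and chord_y = has_vector_derivative_scaleR[OF _ has_vector_derivative_chord_square(2)[OF G(2)]]
  have derx: "((\<lambda>x. fx x y \<theta>) has_vector_derivative fxx x y \<theta>) (at x)"
    "((\<lambda>y. fx x y \<theta>) has_vector_derivative fxy x y \<theta>) (at y)" for x y \<theta>
    unfolding fx_def fxx_def fxy_def by (rule chord_x chord_y; auto intro!: derivative_eq_intros; fail)+
  have dery: "((\<lambda>x. fy x y \<theta>) has_vector_derivative fyx x y \<theta>) (at x)"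
    "((\<lambda>y. fy x y \<theta>) has_vector_derivative fyy x y \<theta>) (at y)" for x y \<theta>
    unfolding fy_def fyx_def fyy_def by (rule chord_x chord_y; auto intro!: derivative_eq_intros; fail)+
  let ?W = "parameter_integral k 0 pi"
  note W = C1_quadrant_parameter_integral[OF k der cont(1-3)]
    and Wx = C1_quadrant_parameter_integral[OF k derx cont(2,4,6)]
    and Wy = C1_quadrant_parameter_integral[OF k dery cont(3,7,5)]
  have C2: "C2_quadrant (?W f)"
    by (rule C2_quadrantI[OF W(4,5) W(6) Wx(1) Wy(1)])
  have pxx: "partial_x (partial_x (?W f)) x y = ?W fxx x y" if "x \<ge> 0" "y \<ge> 0" for x y
    using partial_x_cong[where u = "partial_x (?W f)" and v = "?W fx", OF that(1) W(2) Wx(1) that(2)] Wx(2)[OF that(1)] by simp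
  have pyy: "partial_y (partial_y (?W f)) x y = ?W fyy x y" if "x \<ge> 0" "y \<ge> 0" for x y
    using partial_y_cong[where u = "partial_y (?W f)" and v = "?W fy", OF that(2) W(3) Wy(1) that(1)] Wy(3)[OF that(2)] by simp
  have int: "((\<lambda>\<theta>. k \<theta> *\<^sub>R g x y \<theta>) has_integral ?W g x y) {0..pi}"
    if "continuous_on UNIV (\<lambda>(x, y, \<theta>). g x y \<theta>)" for g x y
  proof -
    have "continuous_on {0..pi} (g x y)"
      using continuous_on_compose2[OF that, of "{0..pi}" "\<lambda>\<theta>. (x, y, \<theta>)"] by (simp add: continuous_on_Pair)
    from integrable_weighted[OF this k] show ?thesis
      unfolding parameter_integral_def by (rule integrable_integral)
  qed
  have pde: "?W fxx x y + ((2 * \<nu> + 1) / x) *\<^sub>R ?W fx x y = ?W fyy x y + ((2 * \<nu> + 1) / y) *\<^sub>R ?W fy x y"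
    if "x > 0" "y > 0" for x y
  proof -
    define r where "r = (x\<^sup>2 - y\<^sup>2) / (x * y)"
    have eq: "(k \<theta> *\<^sub>R fxx x y \<theta> + ((2 * \<nu> + 1) / x) *\<^sub>R k \<theta> *\<^sub>R fx x y \<theta>)
        - (k \<theta> *\<^sub>R fyy x y \<theta> + ((2 * \<nu> + 1) / y) *\<^sub>R k \<theta> *\<^sub>R fy x y \<theta>)
      = r *\<^sub>R (k \<theta> *\<^sub>R ((4 * x * y * (sin \<theta>)\<^sup>2) *\<^sub>R G2 (chord_square x y \<theta>)
             + (2 * (2 * \<nu> + 1) * cos \<theta>) *\<^sub>R G1 (chord_square x y \<theta>)))" for \<theta>
    proof -
      define A where "A = G1 (chord_square x y \<theta>)"
      define B where "B = G2 (chord_square x y \<theta>)"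
      have b: "(2 * (x - y * cos \<theta>)) * (2 * (x - y * cos \<theta>)) - (2 * (y - x * cos \<theta>)) * (2 * (y - x * cos \<theta>))
          = r * (4 * x * y * (sin \<theta>)\<^sup>2)"
        unfolding sin_squared_eq r_def using that by (simp add: field_simps power2_eq_square)
      have a: "(2 * \<nu> + 1) / x * (2 * (x - y * cos \<theta>)) - (2 * \<nu> + 1) / y * (2 * (y - x * cos \<theta>))
          = r * (2 * (2 * \<nu> + 1) * cos \<theta>)"
        unfolding r_def using that by (simp add: field_simps power2_eq_square)
      have "(k \<theta> *\<^sub>R fxx x y \<theta> + ((2 * \<nu> + 1) / x) *\<^sub>R k \<theta> *\<^sub>R fx x y \<theta>)
        - (k \<theta> *\<^sub>R fyy x y \<theta> + ((2 * \<nu> + 1) / y) *\<^sub>R k \<theta> *\<^sub>R fy x y \<theta>)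
        = k \<theta> *\<^sub>R (((2 * (x - y * cos \<theta>)) * (2 * (x - y * cos \<theta>)) - (2 * (y - x * cos \<theta>)) * (2 * (y - x * cos \<theta>))) *\<^sub>R B
          + ((2 * \<nu> + 1) / x * (2 * (x - y * cos \<theta>)) - (2 * \<nu> + 1) / y * (2 * (y - x * cos \<theta>))) *\<^sub>R A)"
        unfolding fxx_def fyy_def fx_def fy_def A_def[symmetric] B_def[symmetric]
        by (simp only: scaleR_scaleR scaleR_add_right scaleR_diff_left scaleR_diff_right mult_ac)
           (simp add: algebra_simps)
      then show ?thesis
        unfolding a b A_def[symmetric] B_def[symmetric]
        by (simp only: scaleR_scaleR scaleR_add_right mult_ac)
    qed
    have "((\<lambda>\<theta>. (k \<theta> *\<^sub>R fxx x y \<theta> + ((2 * \<nu> + 1) / x) *\<^sub>R k \<theta> *\<^sub>R fx x y \<theta>)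
        - (k \<theta> *\<^sub>R fyy x y \<theta> + ((2 * \<nu> + 1) / y) *\<^sub>R k \<theta> *\<^sub>R fy x y \<theta>)) has_integral
        (?W fxx x y + ((2 * \<nu> + 1) / x) *\<^sub>R ?W fx x y) - (?W fyy x y + ((2 * \<nu> + 1) / y) *\<^sub>R ?W fy x y)) {0..pi}"
      by (intro has_integral_diff has_integral_add has_integral_cmul int cont)
    moreover have "((\<lambda>\<theta>. r *\<^sub>R (k \<theta> *\<^sub>R ((4 * x * y * (sin \<theta>)\<^sup>2) *\<^sub>R G2 (chord_square x y \<theta>)
             + (2 * (2 * \<nu> + 1) * cos \<theta>) *\<^sub>R G1 (chord_square x y \<theta>)))) has_integral r *\<^sub>R 0) {0..pi}"
      unfolding k_def by (intro has_integral_cmul integral_angular_kernel_identity nu G)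
    ultimately have "(?W fxx x y + ((2 * \<nu> + 1) / x) *\<^sub>R ?W fx x y)
        - (?W fyy x y + ((2 * \<nu> + 1) / y) *\<^sub>R ?W fy x y) = r *\<^sub>R 0"
      unfolding eq by (rule has_integral_unique)
    then show ?thesis by simp
  qed
  have init: "?W f x 0 = G (x\<^sup>2)" for x
  proof -
    have "?W f x 0 = integral {0..pi} k *\<^sub>R G (x\<^sup>2)"
      using k by (simp add: parameter_integral_def f_def chord_square_def absolutely_integrable_on_def
          has_integral_scaleR_left integrable_integral integral_unique)
    then show ?thesis by (simp add: k_def integral_angular_kernel[OF nu])
  qed
  have init': "?W fy x 0 = 0" for x
  proof -
    \<comment> \<open>At \<open>y = 0\<close> the identity reduces to its second term; the factor turns it into the integrand of \<open>w\<^sub>y\<close>.\<close>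
    have "((\<lambda>\<theta>. (- x / (2 * \<nu> + 1)) *\<^sub>R (k \<theta> *\<^sub>R ((4 * x * 0 * (sin \<theta>)\<^sup>2) *\<^sub>R G2 (chord_square x 0 \<theta>)
             + (2 * (2 * \<nu> + 1) * cos \<theta>) *\<^sub>R G1 (chord_square x 0 \<theta>)))) has_integral (- x / (2 * \<nu> + 1)) *\<^sub>R 0) {0..pi}"
      unfolding k_def by (intro has_integral_cmul integral_angular_kernel_identity nu G)
    moreover have "(- x / (2 * \<nu> + 1)) *\<^sub>R (k \<theta> *\<^sub>R ((4 * x * 0 * (sin \<theta>)\<^sup>2) *\<^sub>R G2 (chord_square x 0 \<theta>)
             + (2 * (2 * \<nu> + 1) * cos \<theta>) *\<^sub>R G1 (chord_square x 0 \<theta>))) = k \<theta> *\<^sub>R fy x 0 \<theta>" for \<theta>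
    proof -
      have "(- x / (2 * \<nu> + 1)) * (k \<theta> * (2 * (2 * \<nu> + 1) * cos \<theta>)) = k \<theta> * (2 * (0 - x * cos \<theta>))"
        using nu by (simp add: divide_simps)
      then show ?thesis by (simp only: fy_def scaleR_scaleR mult_zero_right mult_zero_left scaleR_zero_left add_0)
    qed
    ultimately have "((\<lambda>\<theta>. k \<theta> *\<^sub>R fy x 0 \<theta>) has_integral 0) {0..pi}" by simp
    with int[OF cont(3), of x 0] show ?thesis by (rule has_integral_unique)
  qed
  show ?thesis
    unfolding bessel_problem_def k_def[symmetric] f_def[symmetric]
    using C2 pde init init' by (auto simp: pxx pyy W(2,3))
qed

section \<open>Uniqueness: a weighted energy estimate\<close>

text \<open>
  Integrating \<open>u\<^sub>x\<close> in \<open>x\<close> and differentiating under the integral sign in \<open>y\<close> gives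
  \<open>u\<^sub>y(z,y) - u\<^sub>y(0,y) = \<integral>\<^sub>0\<^sup>z u\<^sub>x\<^sub>y(s,y) ds\<close>, and the fundamental theorem of calculus differentiates this in \<open>z\<close>.
\<close>
lemma mixed_partials_eq:
  assumes u: "C2_quadrant u" and x: "x > 0" and y: "y \<ge> 0"
  shows "partial_y (partial_x u) x y = partial_x (partial_y u) x y"
proof -
  note C = C2_quadrantD[OF u]
  have sec: "continuous_on {0..b} (\<lambda>s. h s t)"
    if "continuous_on ({0..} \<times> {0..}) (\<lambda>(x, y). h x y)" "t \<ge> 0" for h :: "real \<Rightarrow> real \<Rightarrow> complex" and t b
  proof -
    have "continuous_on {0..b} (\<lambda>s. (\<lambda>(x, y). h x y) (s, t))"
      by (rule continuous_on_compose2[OF that(1)]) (use that(2) in \<open>auto intro!: continuous_intros\<close>)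
    then show ?thesis by simp
  qed
  have ftc: "integral {0..z} (\<lambda>s. partial_x u s t) = u z t - u 0 t" if "z \<ge> 0" "t \<ge> 0" for z t
    by (rule integral_unique, rule fundamental_theorem_of_calculus)
       (use that in \<open>auto intro: has_vector_derivative_within_subset[OF C1_quadrantD(1)[OF C(1)]]\<close>)
  have diff_y: "partial_y u z y = partial_y u 0 y + integral {0..z} (\<lambda>s. partial_y (partial_x u) s y)" if z: "z \<ge> 0" for z
  proof -
    have "((\<lambda>t. integral (cbox 0 z) (\<lambda>s. partial_x u s t)) has_vector_derivative
        integral (cbox 0 z) (\<lambda>s. partial_y (partial_x u) s y)) (at y within {0..})"
    proof (rule leibniz_rule_vector_derivative)
      show "((\<lambda>t. partial_x u s t) has_vector_derivative partial_y (partial_x u) s t) (at t within {0..})"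
        if "t \<in> {0..}" "s \<in> cbox 0 z" for t s
        using C1_quadrantD(2)[OF C(2), of s t] that by auto
      show "(\<lambda>s. partial_x u s t) integrable_on cbox 0 z" if "t \<in> {0..}" for t
        using integrable_continuous_real[OF sec[OF C1_quadrantD(3)[OF C(2)]]] that by simp
      show "continuous_on ({0..} \<times> cbox 0 z) (\<lambda>(t, s). partial_y (partial_x u) s t)"
      proof -
        have "continuous_on ({0..} \<times> cbox 0 z) (\<lambda>p. (\<lambda>(x, y). partial_y (partial_x u) x y) (snd p, fst p))"
          by (rule continuous_on_compose2[OF C1_quadrantD(5)[OF C(2)]]) (auto intro!: continuous_intros)
        then show ?thesis by (simp add: split_beta)
      qed
    qed (use y in auto)
    from has_vector_derivative_transform[OF _ _ this, of "\<lambda>t. u z t - u 0 t"]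
    have "((\<lambda>t. u z t - u 0 t) has_vector_derivative integral {0..z} (\<lambda>s. partial_y (partial_x u) s y)) (at y within {0..})"
      using y z ftc by simp
    moreover have "((\<lambda>t. u z t - u 0 t) has_vector_derivative partial_y u z y - partial_y u 0 y) (at y within {0..})"
      by (intro has_vector_derivative_diff C1_quadrantD(2)[OF C(1)] z y order_refl)
    ultimately have "integral {0..z} (\<lambda>s. partial_y (partial_x u) s y) = partial_y u z y - partial_y u 0 y"
      by (rule vector_derivative_unique_within[OF at_within_Ici_nontrivial[OF y]])
    then show ?thesis by simp
  qed
  have "((\<lambda>z. integral {0..z} (\<lambda>s. partial_y (partial_x u) s y)) has_vector_derivative partial_y (partial_x u) x y)
      (at x within {0..x + 1})"
    by (rule integral_has_vector_derivative) (use x y sec C1_quadrantD(5)[OF C(2)] in auto)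
  then have "((\<lambda>z. integral {0..z} (\<lambda>s. partial_y (partial_x u) s y)) has_vector_derivative partial_y (partial_x u) x y) (at x)"
    using at_within_interior[of x "{0..x + 1}"] x by simp
  then have "((\<lambda>z. partial_y u 0 y + integral {0..z} (\<lambda>s. partial_y (partial_x u) s y)) has_vector_derivative partial_y (partial_x u) x y) (at x)"
    by (simp add: has_vector_derivative_add_const add.commute[of "partial_y u 0 y"])
  then have "((\<lambda>z. partial_y u z y) has_vector_derivative partial_y (partial_x u) x y) (at x)"
    by (rule has_vector_derivative_transform_within_open[of _ _ _ "{0<..}"])
       (auto simp: x intro!: diff_y[symmetric])
  then have "((\<lambda>z. partial_y u z y) has_vector_derivative partial_y (partial_x u) x y) (at x within {0..})"
    by (rule has_vector_derivative_at_within)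
  then show ?thesis
    using partial_x_eqI[of x "partial_y u"] x by simp
qed

lemma has_real_derivative_max_square:
  "((\<lambda>z::real. (max 0 z)\<^sup>2) has_real_derivative 2 * max 0 z) (at z)"
proof (cases z "0::real" rule: linorder_cases)
  case less
  have "((\<lambda>z::real. 0) has_real_derivative 2 * max 0 z) (at z)" using less by simp
  then show ?thesis
    by (rule has_field_derivative_transform_within_open[of _ _ _ "{..<0}"]) (use less in auto)
next
  case equal
  have "(\<lambda>y::real. (max 0 y)\<^sup>2 / y) = (\<lambda>y. max 0 y)"
    by (auto simp: fun_eq_iff max_def power2_eq_square)
  moreover have "((\<lambda>y::real. max 0 y) \<longlongrightarrow> max 0 0) (at 0)"
    by (intro tendsto_intros)
  ultimately show ?thesis using equal by (simp add: has_field_derivative_iff)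
next
  case greater
  have "((\<lambda>z::real. z\<^sup>2) has_real_derivative 2 * max 0 z) (at z)"
    using greater by (auto intro!: derivative_eq_intros)
  then show ?thesis
    by (rule has_field_derivative_transform_within_open[of _ _ _ "{0<..}"]) (use greater in auto)
qed

text \<open>
  The pointwise inequality behind the energy estimate, with \<open>p\<close>, \<open>p'\<close>, \<open>X\<close> the values of the cutoff, of
  its derivative and of \<open>x\<^sup>\<alpha>\<close>. The right-hand side is twice the \<open>x\<close>-derivative of the flux, and
  its excess over the left-hand side is \<open>- p' X |w\<^sub>x - w\<^sub>y|\<^sup>2 + 2 p X (\<alpha>/y) |w\<^sub>y|\<^sup>2\<close>.
\<close>
lemma energy_density_le:
  fixes wx wy wxx wxy wyy :: "'a::real_inner"
  assumes x: "x > 0" and y: "y > 0" and "\<alpha> \<ge> 0" "p \<ge> 0" "p' \<le> 0" "X \<ge> 0"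
    and eq: "wxx + (\<alpha> / x) *\<^sub>R wx = wyy + (\<alpha> / y) *\<^sub>R wy"
  shows "p' * (X * (wx \<bullet> wx + wy \<bullet> wy)) + p * (X * (2 * (wx \<bullet> wxy) + 2 * (wy \<bullet> wyy)))
    \<le> 2 * (p' * (X * (wx \<bullet> wy)) + p * (\<alpha> * (X / x) * (wx \<bullet> wy) + X * (wxx \<bullet> wy + wx \<bullet> wxy)))"
proof -
  have wyy: "wyy = wxx + (\<alpha> / x) *\<^sub>R wx - (\<alpha> / y) *\<^sub>R wy" using eq by (simp add: algebra_simps)
  have "2 * (p' * (X * (wx \<bullet> wy)) + p * (\<alpha> * (X / x) * (wx \<bullet> wy) + X * (wxx \<bullet> wy + wx \<bullet> wxy)))
     - (p' * (X * (wx \<bullet> wx + wy \<bullet> wy)) + p * (X * (2 * (wx \<bullet> wxy) + 2 * (wy \<bullet> wyy))))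
    = (- p') * X * ((wx - wy) \<bullet> (wx - wy)) + 2 * p * X * (\<alpha> / y) * (wy \<bullet> wy)"
    unfolding wyy by (simp add: inner_simps inner_commute algebra_simps)
  moreover have "\<dots> \<ge> 0"
    using assms by (intro add_nonneg_nonneg mult_nonneg_nonneg divide_nonneg_nonneg inner_ge_zero) auto
  ultimately show ?thesis by linarith
qed

text \<open>
  The energy argument. The cutoff \<open>\<phi>(s + t)\<close> vanishes for \<open>s + t \<ge> R\<close> and \<open>s\<^sup>\<alpha>\<close> vanishes at \<open>s = 0\<close>, so
  there is no flux through either end of \<open>[0,R]\<close>; choosing \<open>R\<close> beyond \<open>x + y\<close> makes the
  vanishing of the energy at height \<open>y\<close> informative at the given point.
\<close>
lemma bessel_problem_zero_imp_partial_y_zero: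
  assumes nu: "\<nu> > - 1 / 2" and w: "bessel_problem \<nu> (\<lambda>_. 0) w" and x: "x > 0" and y: "y \<ge> 0"
  shows "partial_y w x y = 0"
proof -
  define \<alpha> where "\<alpha> = 2 * \<nu> + 1"
  have \<alpha>: "\<alpha> > 0" using nu by (simp add: \<alpha>_def)
  have C2: "C2_quadrant w" using w by (simp add: bessel_problem_def)
  note C = C2_quadrantD[OF C2]
  define R where "R = x + y + 1"
  have R: "R > 0" "x + y < R" using x y by (auto simp: R_def)
  define \<phi> where "\<phi> = (\<lambda>s. (max 0 (R - s))\<^sup>2)"
  define \<phi>' where "\<phi>' = (\<lambda>s. - (2 * max 0 (R - s)))"
  have "((\<lambda>s. (max 0 (R - s))\<^sup>2) has_real_derivative 2 * max 0 (R - s) * (- 1)) (at s)" for s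
    by (rule DERIV_chain2[OF has_real_derivative_max_square]) (auto intro!: derivative_eq_intros)
  then have "(\<phi> has_real_derivative \<phi>' s) (at s)" for s
    by (simp add: \<phi>_def \<phi>'_def)
  note \<phi>_chain = DERIV_chain2[OF this]
  have \<phi>: "((\<lambda>s. \<phi> (s + c)) has_real_derivative \<phi>' (s + c)) (at s within S)"
    "((\<lambda>s. \<phi> (c + s)) has_real_derivative \<phi>' (c + s)) (at s within S)" for s c S
  proof -
    have "((\<lambda>s. s + c) has_real_derivative 1) (at s within S)" "((\<lambda>s. c + s) has_real_derivative 1) (at s within S)"
      by (auto intro!: derivative_eq_intros)
    from this[THEN \<phi>_chain]
    show "((\<lambda>s. \<phi> (s + c)) has_real_derivative \<phi>' (s + c)) (at s within S)"
      "((\<lambda>s. \<phi> (c + s)) has_real_derivative \<phi>' (c + s)) (at s within S)" by simp_all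
  qed
  have c\<phi>: "continuous_on S (\<lambda>z. \<phi> (p z + q z))" "continuous_on S (\<lambda>z. \<phi>' (p z + q z))"
    if "continuous_on S p" "continuous_on S q" for S :: "'z::topological_space set" and p q
    unfolding \<phi>_def \<phi>'_def using that by (auto intro!: continuous_intros)
  have cpow: "continuous_on S (\<lambda>z. q z powr \<alpha>)" if "continuous_on S q" "\<And>z. z \<in> S \<Longrightarrow> q z \<ge> 0"
    for S :: "'z::topological_space set" and q
    by (rule continuous_on_powr') (use that \<alpha> in auto)
  \<comment> \<open>\<open>F\<close> is the energy density with \<open>t\<close>-derivative \<open>F'\<close>, and \<open>J\<close> the flux with \<open>s\<close>-derivative \<open>J'\<close>.\<close>
  define F where "F = (\<lambda>t s. \<phi> (s + t) * (s powr \<alpha> * (partial_x w s t \<bullet> partial_x w s t + partial_y w s t \<bullet> partial_y w s t)))"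
  define F' where "F' = (\<lambda>t s. \<phi>' (s + t) * (s powr \<alpha> * (partial_x w s t \<bullet> partial_x w s t + partial_y w s t \<bullet> partial_y w s t))
      + \<phi> (s + t) * (s powr \<alpha> * (2 * (partial_x w s t \<bullet> partial_y (partial_x w) s t)
                                + 2 * (partial_y w s t \<bullet> partial_y (partial_y w) s t))))"
  define J where "J = (\<lambda>t s. \<phi> (s + t) * (s powr \<alpha> * (partial_x w s t \<bullet> partial_y w s t)))"
  define J' where "J' = (\<lambda>t s. \<phi>' (s + t) * (s powr \<alpha> * (partial_x w s t \<bullet> partial_y w s t))
      + \<phi> (s + t) * (\<alpha> * (s powr \<alpha> / s) * (partial_x w s t \<bullet> partial_y w s t)
          + s powr \<alpha> * (partial_x (partial_x w) s t \<bullet> partial_y w s t + partial_x w s t \<bullet> partial_y (partial_x w) s t)))"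
  have comp: "continuous_on S (\<lambda>z. h (q z) (p z))"
    if "continuous_on ({0..} \<times> {0..}) (\<lambda>(x, y). h x y)" "continuous_on S p" "continuous_on S q"
      "\<And>z. z \<in> S \<Longrightarrow> p z \<ge> 0 \<and> q z \<ge> 0"
    for h :: "real \<Rightarrow> real \<Rightarrow> complex" and S :: "'z::topological_space set" and p q
  proof -
    have "continuous_on S (\<lambda>z. (\<lambda>(x, y). h x y) (q z, p z))"
      by (rule continuous_on_compose2[OF that(1)]) (use that(2-) in \<open>auto intro!: continuous_intros\<close>)
    then show ?thesis by simp
  qed
  note D = C1_quadrantD(3)[OF C(2)] C1_quadrantD(3)[OF C(3)]
    C1_quadrantD(5)[OF C(2)] C1_quadrantD(5)[OF C(3)]
  have contF: "continuous_on S (\<lambda>z. F (p z) (q z))" "continuous_on S (\<lambda>z. F' (p z) (q z))"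
      "continuous_on S (\<lambda>z. J (p z) (q z))"
    if "continuous_on S p" "continuous_on S q" "\<And>z. z \<in> S \<Longrightarrow> p z \<ge> 0 \<and> q z \<ge> 0"
    for S :: "'z::topological_space set" and p q
  proof -
    have q: "\<And>z. z \<in> S \<Longrightarrow> q z \<ge> 0" using that(3) by blast
    note c = c\<phi>[OF that(2,1)] cpow[OF that(2) q] comp[OF D(1) that] comp[OF D(2) that]
      comp[OF D(3) that] comp[OF D(4) that]
    show "continuous_on S (\<lambda>z. F (p z) (q z))" "continuous_on S (\<lambda>z. F' (p z) (q z))"
        "continuous_on S (\<lambda>z. J (p z) (q z))"
      unfolding F_def F'_def J_def
      by (intro continuous_on_add continuous_on_mult continuous_on_inner continuous_on_const c; assumption)+
  qed
  have contF_sec: "continuous_on {0..R} (F t)" "continuous_on {0..R} (F' t)" "continuous_on {0..R} (J t)" if "t \<ge> 0" for t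
  proof -
    have "continuous_on {0..R} (\<lambda>_. t)" "continuous_on {0..R} (\<lambda>s. s)" "\<And>s. s \<in> {0..R} \<Longrightarrow> t \<ge> 0 \<and> s \<ge> 0"
      using that by auto
    from contF[OF this] show "continuous_on {0..R} (F t)" "continuous_on {0..R} (F' t)" "continuous_on {0..R} (J t)" by simp_all
  qed
  define E where "E = (\<lambda>t. integral {0..R} (F t))"
  have E': "(E has_vector_derivative integral {0..R} (F' t)) (at t within {0..})" if t: "t \<ge> 0" for t
  proof -
    have "((\<lambda>t. integral (cbox 0 R) (F t)) has_vector_derivative integral (cbox 0 R) (F' t)) (at t within {0..})"
    proof (rule leibniz_rule_vector_derivative)
      show "((\<lambda>t. F t s) has_vector_derivative F' t s) (at t within {0..})" if "t \<in> {0..}" "s \<in> cbox 0 R" for t s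
      proof -
        have st: "s \<ge> 0" "t \<ge> 0" using that by auto
        have n: "((\<lambda>t. h s t \<bullet> h s t) has_real_derivative 2 * (h s t \<bullet> partial_y h s t)) (at t within {0..})"
          if "C1_quadrant h" for h
          using bounded_bilinear.has_vector_derivative[OF bounded_bilinear_inner
              C1_quadrantD(2)[OF that st] C1_quadrantD(2)[OF that st]]
          by (simp only: has_real_derivative_iff_has_vector_derivative mult_2 inner_commute[of "partial_y h s t" "h s t"])
        have "((\<lambda>t. F t s) has_real_derivative F' t s) (at t within {0..})"
          unfolding F_def F'_def
          by (rule DERIV_cong[OF DERIV_mult[OF \<phi>(2) DERIV_cmult[OF DERIV_add[OF n[OF C(2)] n[OF C(3)]]]]]) simp
        then show ?thesis by (simp add: has_real_derivative_iff_has_vector_derivative)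
      qed
      show "F t integrable_on cbox 0 R" if "t \<in> {0..}" for t
        using integrable_continuous_real[OF contF_sec(1)] that by simp
      show "continuous_on ({0..} \<times> cbox 0 R) (\<lambda>(t, s). F' t s)"
        unfolding split_beta by (rule contF(2)) (auto intro!: continuous_intros)
    qed (use t in auto)
    then show ?thesis by (simp add: E_def)
  qed
  have flux: "(J' t has_integral 0) {0..R}" if t: "t > 0" for t
  proof -
    have "(J' t has_integral J t R - J t 0) {0..R}"
    proof (rule fundamental_theorem_of_calculus_interior)
      show "continuous_on {0..R} (J t)" using contF_sec(3) t by simp
      show "(J t has_vector_derivative J' t s) (at s)" if "s \<in> {0<..<R}" for s
      proof -
        have st: "s \<ge> 0" "t \<ge> 0" "s > 0" using that t by auto
        have i: "((\<lambda>s. partial_x w s t \<bullet> partial_y w s t) has_real_derivative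
            partial_x w s t \<bullet> partial_y (partial_x w) s t + partial_x (partial_x w) s t \<bullet> partial_y w s t) (at s)"
          using bounded_bilinear.has_vector_derivative[OF bounded_bilinear_inner
              C1_quadrantD(1)[OF C(2) st(1,2)] C1_quadrantD(1)[OF C(3) st(1,2)]]
          unfolding mixed_partials_eq[OF C2 st(3,2)] at_within_Ici_interior[OF st(3)]
          by (simp add: has_real_derivative_iff_has_vector_derivative)
        have p: "((\<lambda>s. s powr \<alpha>) has_real_derivative \<alpha> * (s powr \<alpha> / s)) (at s)"
          by (rule DERIV_cong[OF DERIV_powr[OF DERIV_ident st(3) DERIV_const]]) (use st in simp)
        have "(J t has_real_derivative J' t s) (at s)"
          unfolding J_def J'_def
          by (rule DERIV_cong[OF DERIV_mult[OF \<phi>(1) DERIV_mult[OF p i]]]) (simp add: algebra_simps)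
        then show ?thesis by (simp add: has_real_derivative_iff_has_vector_derivative)
      qed
    qed (use R in simp)
    moreover have "J t R = 0" "J t 0 = 0" using t by (auto simp: J_def \<phi>_def)
    ultimately show ?thesis by simp
  qed
  have E'_le: "integral {0..R} (F' t) \<le> 0" if t: "t > 0" for t
  proof -
    have le: "F' t s \<le> 2 * J' t s" if s: "s \<in> {0..R}" for s
    proof (cases "s = 0")
      \<comment> \<open>Here \<open>0 powr \<alpha> = 0\<close> and division by zero is 0, so both sides are 0.\<close>
      case True
      then show ?thesis by (simp add: F'_def J'_def)
    next
      case False
      then have s0: "s > 0" using s by auto
      have eq: "partial_x (partial_x w) s t + (\<alpha> / s) *\<^sub>R partial_x w s t = partial_y (partial_y w) s t + (\<alpha> / t) *\<^sub>R partial_y w s t"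
        using w s0 t by (simp add: bessel_problem_def \<alpha>_def)
      show ?thesis
        unfolding F'_def J'_def by (rule energy_density_le[OF s0 t _ _ _ _ eq]) (use \<alpha> in \<open>auto simp: \<phi>_def \<phi>'_def\<close>)
    qed
    have "continuous_on {0..R} (F' t)"
      using contF_sec(2) t by simp
    then have "(F' t has_integral integral {0..R} (F' t)) {0..R}"
      by (intro integrable_integral integrable_continuous_real)
    moreover have "((\<lambda>s. 2 * J' t s) has_integral 2 * 0) {0..R}"
      by (intro has_integral_mult_right flux t)
    ultimately have "integral {0..R} (F' t) \<le> 2 * 0"
      by (rule has_integral_le) (rule le)
    then show ?thesis by simp
  qed
  have init: "F 0 s = 0" if "s \<ge> 0" for s
  proof -
    have "((\<lambda>s. w s 0) has_vector_derivative 0) (at s within {0..})"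
      using has_vector_derivative_transform[of s "{0..}" "\<lambda>s. w s 0" "\<lambda>_. 0" 0] that w
      by (simp add: bessel_problem_def)
    then have "partial_x w s 0 = 0" by (rule partial_x_eqI[OF that])
    moreover have "partial_y w s 0 = 0" using that w by (simp add: bessel_problem_def)
    ultimately show ?thesis by (simp add: F_def)
  qed
  have E0: "E 0 = 0"
    unfolding E_def by (rule integral_unique[OF has_integral_eq[OF _ has_integral_0]]) (simp add: init)
  have F_nonneg: "F t s \<ge> 0" for t s by (simp add: F_def \<phi>_def)
  have "E y \<le> E 0"
  proof (cases "y = 0")
    case False
    show ?thesis
    proof (rule DERIV_nonpos_imp_decreasing_open[of 0 y E])
      show "\<exists>d. DERIV E t :> d \<and> d \<le> 0" if "0 < t" "t < y" for t
        using E'[of t] E'_le[OF that(1)] that unfolding at_within_Ici_interior[OF that(1)]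
        by (auto simp: has_real_derivative_iff_has_vector_derivative)
      show "continuous_on {0..y} E"
        by (rule continuous_on_vector_derivative[where f' = "\<lambda>t. integral {0..R} (F' t)"])
           (rule has_vector_derivative_within_subset[OF E'], auto)
    qed (use y False in auto)
  qed simp
  then have "integral {0..R} (F y) = 0"
    using E0 integral_nonneg[OF integrable_continuous_real[OF contF_sec(1)[OF y]]] F_nonneg
    by (simp add: E_def order_antisym)
  then have "\<forall>s\<in>{0..R}. F y s = 0"
    using integral_eq_0_iff[OF contF_sec(1)[OF y] R(1)] F_nonneg by blast
  then have "F y x = 0" using x y R by simp
  moreover have "\<phi> (x + y) \<noteq> 0" "x powr \<alpha> \<noteq> 0" using x R by (auto simp: \<phi>_def)
  ultimately have "partial_x w x y \<bullet> partial_x w x y + partial_y w x y \<bullet> partial_y w x y = 0"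
    by (simp add: F_def)
  then show ?thesis by (simp add: add_nonneg_eq_0_iff)
qed

text \<open>
  For \<open>x > 0\<close> the solution is constant in \<open>y\<close>, hence equal to its initial value 0. On the axis \<open>x = 0\<close>,
  where the weight \<open>x\<^sup>\<alpha>\<close> of the energy gives no information, it is 0 by continuity.
\<close>
lemma bessel_problem_zero_imp_zero:
  assumes nu: "\<nu> > - 1 / 2" and w: "bessel_problem \<nu> (\<lambda>_. 0) w" and x: "x \<ge> 0" and y: "y \<ge> 0"
  shows "w x y = 0"
proof -
  have C1: "C1_quadrant w" using w by (simp add: bessel_problem_def C2_quadrant_def)
  have pos: "w s y = 0" if s: "s > 0" for s
  proof -
    have "((\<lambda>t. w s t) has_vector_derivative 0) (at t within {0..})" if "t \<in> {0..}" for t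
      using C1_quadrantD(2)[OF C1, of s t] bessel_problem_zero_imp_partial_y_zero[OF nu w s, of t] s that by simp
    then obtain c where "\<And>t. t \<in> {0..} \<Longrightarrow> w s t = c"
      using has_vector_derivative_zero_constant[of "{0::real..}" "w s"] by blast
    then have "w s y = w s 0" using y by simp
    then show ?thesis using w s by (simp add: bessel_problem_def)
  qed
  have "closure {0<..} = {0::real..}" by simp
  moreover have "continuous_on {0..} (\<lambda>s. w s y)"
    using C1_quadrantD(1)[OF C1 _ y] by (intro continuous_on_vector_derivative) auto
  ultimately show ?thesis
    using continuous_constant_on_closure[of "{0<..}" "\<lambda>s. w s y" 0 x] pos x by simp
qed

lemma bessel_problem_diff:
  assumes u: "bessel_problem \<nu> g u" and v: "bessel_problem \<nu> h v"
  shows "bessel_problem \<nu> (\<lambda>x. g x - h x) (\<lambda>x y. u x y - v x y)"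
proof -
  have C2: "C2_quadrant u" "C2_quadrant v" using u v by (simp_all add: bessel_problem_def)
  note U = C2_quadrantD[OF C2(1)] and V = C2_quadrantD[OF C2(2)]
  note d = C1_quadrant_diff[OF U(1) V(1)]
    and dx = C1_quadrant_diff[OF U(2) V(2)]
    and dy = C1_quadrant_diff[OF U(3) V(3)]
  have xx: "partial_x (partial_x (\<lambda>x y. u x y - v x y)) x y = partial_x (partial_x u) x y - partial_x (partial_x v) x y"
    and yy: "partial_y (partial_y (\<lambda>x y. u x y - v x y)) x y = partial_y (partial_y u) x y - partial_y (partial_y v) x y"
    if "x \<ge> 0" "y \<ge> 0" for x y
    using partial_x_cong[of x "partial_x (\<lambda>x y. u x y - v x y)" y "\<lambda>x y. partial_x u x y - partial_x v x y"]
      partial_y_cong[of y "partial_y (\<lambda>x y. u x y - v x y)" x "\<lambda>x y. partial_y u x y - partial_y v x y"]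
      d(2,3) dx(1,2) dy(1,3) that by simp_all
  have pde: "partial_x (partial_x w) x y + ((2 * \<nu> + 1) / x) *\<^sub>R partial_x w x y =
      partial_y (partial_y w) x y + ((2 * \<nu> + 1) / y) *\<^sub>R partial_y w x y"
    if "w \<in> {u, v}" "x > 0" "y > 0" for w x y
    using that u v by (auto simp: bessel_problem_def)
  show ?thesis
    unfolding bessel_problem_def
  proof (intro conjI allI impI)
    show "C2_quadrant (\<lambda>x y. u x y - v x y)" by (rule C2_quadrant_diff[OF C2])
    fix x :: real
    show "u x 0 - v x 0 = g x - h x" if "x \<ge> 0" using u v that by (simp add: bessel_problem_def)
    show "partial_y (\<lambda>x y. u x y - v x y) x 0 = 0" if "x \<ge> 0"
      using u v that by (simp add: d bessel_problem_def)
    fix y :: real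
    assume xy: "x > 0" "y > 0"
    then show "partial_x (partial_x (\<lambda>x y. u x y - v x y)) x y + ((2 * \<nu> + 1) / x) *\<^sub>R partial_x (\<lambda>x y. u x y - v x y) x y =
        partial_y (partial_y (\<lambda>x y. u x y - v x y)) x y + ((2 * \<nu> + 1) / y) *\<^sub>R partial_y (\<lambda>x y. u x y - v x y) x y"
      using pde[of u x y] pde[of v x y] by (simp add: xx yy d scaleR_diff_right) (simp add: algebra_simps)
  qed
qed

lemma bessel_problem_unique:
  assumes nu: "\<nu> > - 1 / 2" and u: "bessel_problem \<nu> g u" and v: "bessel_problem \<nu> g v"
    and x: "x \<ge> 0" and y: "y \<ge> 0"
  shows "u x y = v x y"
  using bessel_problem_zero_imp_zero[OF nu _ x y, of "\<lambda>x y. u x y - v x y"] bessel_problem_diff[OF u v] by simp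

text \<open>
  The chirp is itself a smooth function of \<open>s\<^sup>2\<close>, so it can be multiplied to the representation of \<open>f\<close>.
\<close>
section \<open>The canonical Bessel problem\<close>

lemma even_smooth_chirp_function_of_square:
  assumes "f \<in> even_smooth"
  obtains G G1 G2 where "\<And>r. (G has_vector_derivative G1 r) (at r)"
    "\<And>r. (G1 has_vector_derivative G2 r) (at r)" "continuous_on UNIV G2" "\<And>s. chirp c s * f s = G (s\<^sup>2)"
proof -
  obtain F F1 F2 where F: "\<And>r. (F has_vector_derivative F1 r) (at r)"
    "\<And>r. (F1 has_vector_derivative F2 r) (at r)" "continuous_on UNIV F2" "\<And>s. f s = F (s\<^sup>2)"
    using even_smooth_function_of_square[OF assms] by blast
  define \<kappa> where "\<kappa> = \<i> * of_real c / 2"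
  define e where "e = (\<lambda>r. exp (of_real r * \<kappa>))"
  have e: "(e has_vector_derivative \<kappa> * e r) (at r)" for r
    unfolding e_def by (rule has_vector_derivative_real_field) (auto intro!: derivative_eq_intros)
  have e': "((\<lambda>r. \<kappa> * e r) has_vector_derivative \<kappa> * (\<kappa> * e r)) (at r)" for r
    by (rule bounded_linear.has_vector_derivative[OF bounded_linear_mult_right e])
  have cont: "continuous_on UNIV F" "continuous_on UNIV F1" "continuous_on UNIV e"
    by (rule has_vector_derivative_imp_continuous_on[OF F(1)] has_vector_derivative_imp_continuous_on[OF F(2)]
          has_vector_derivative_imp_continuous_on[OF e])+
  show ?thesis
  proof
    show "((\<lambda>r. e r * F r) has_vector_derivative e r * F1 r + \<kappa> * e r * F r) (at r)" for r
      by (rule has_vector_derivative_mult[OF e F(1)])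
    show "((\<lambda>r. e r * F1 r + \<kappa> * e r * F r) has_vector_derivative
        (e r * F2 r + \<kappa> * e r * F1 r) + (\<kappa> * e r * F1 r + \<kappa> * (\<kappa> * e r) * F r)) (at r)" for r
      by (intro has_vector_derivative_add has_vector_derivative_mult[OF e F(2)] has_vector_derivative_mult[OF e' F(1)])
    show "continuous_on UNIV (\<lambda>r. (e r * F2 r + \<kappa> * e r * F1 r) + (\<kappa> * e r * F1 r + \<kappa> * (\<kappa> * e r) * F r))"
      by (intro continuous_on_add continuous_on_mult continuous_on_const cont F(3))
    show "chirp c s * f s = e (s\<^sup>2) * F (s\<^sup>2)" for s
      by (simp add: chirp_def e_def \<kappa>_def F(4) mult_ac)
  qed
qed

text \<open>
  Squaring the argument removes the square root of the translation, as \<open>chord_square x y \<theta> \<ge> 0\<close>.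
\<close>
lemma bessel_translation_eq_parameter_integral:
  assumes "\<And>s. g s = G (s\<^sup>2)"
  shows "bessel_translation \<nu> x g y =
           parameter_integral (angular_kernel \<nu>) 0 pi (\<lambda>x y \<theta>. G (chord_square x y \<theta>)) x y"
proof -
  have "g (sqrt (x\<^sup>2 + y\<^sup>2 - 2 * x * y * cos \<theta>)) = G (chord_square x y \<theta>)" for \<theta>
    using chord_square_nonneg[of x y \<theta>] by (simp add: assms chord_square_def)
  then show ?thesis
    unfolding bessel_translation_def parameter_integral_def
    by (simp add: integral_mult_right[symmetric] angular_kernel_def scaleR_conv_of_real mult_ac del: integral_mult_right)
qed

theorem proposition3p1:
  fixes \<nu> :: real and m :: "real^2^2" and f :: "real \<Rightarrow> complex"
  assumes "\<nu> > - 1/2" and "det m = 1" and "m $ 1 $ 2 \<noteq> 0" and "f \<in> even_smooth"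
  shows "\<exists>u. canonical_bessel_problem \<nu> m f u \<and>
           (\<forall>v. canonical_bessel_problem \<nu> m f v \<longrightarrow> (\<forall>x\<ge>0. \<forall>y\<ge>0. v x y = u x y)) \<and>
           (\<forall>x\<ge>0. \<forall>y\<ge>0. u x y =
              exp (\<i> / 2 * of_real (m $ 2 $ 2 / m $ 1 $ 2) * of_real (x\<^sup>2 + y\<^sup>2)) *
              bessel_translation \<nu> x
                (\<lambda>s. exp (- (\<i> / 2) * of_real (m $ 2 $ 2 / m $ 1 $ 2) * of_real (s\<^sup>2)) * f s) y)"
proof -
  define c where "c = m $ 2 $ 2 / m $ 1 $ 2"
  obtain G G1 G2 where G: "\<And>r. (G has_vector_derivative G1 r) (at r)"
    "\<And>r. (G1 has_vector_derivative G2 r) (at r)" "continuous_on UNIV G2" and fG: "\<And>s. chirp (- c) s * f s = G (s\<^sup>2)"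
    using even_smooth_chirp_function_of_square[OF assms(4)] by blast
  define w where "w = parameter_integral (angular_kernel \<nu>) 0 pi (\<lambda>x y \<theta>. G (chord_square x y \<theta>))"
  define u where "u = (\<lambda>x y. chirp c x * chirp c y * w x y)"
  have w: "bessel_problem \<nu> (\<lambda>x. chirp (- c) x * f x) w"
    unfolding fG w_def by (rule bessel_problem_angular_integral[OF assms(1) G])
  have data: "chirp c x * (chirp (- c) x * f x) = f x" for x
    by (simp flip: mult.assoc)
  have u: "canonical_bessel_problem \<nu> m f u"
    using canonical_bessel_problem_of_bessel[OF w, of m, folded c_def] by (simp only: data u_def)
  have unique: "v x y = u x y" if "canonical_bessel_problem \<nu> m f v" "x \<ge> 0" "y \<ge> 0" for v x y
  proof -
    have "chirp (- c) x * chirp (- c) y * v x y = w x y"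
      using bessel_problem_of_canonical[OF that(1)] w that(2,3)
      by (intro bessel_problem_unique[OF assms(1)]) (auto simp: c_def)
    then have "u x y = (chirp c x * chirp (- c) x) * (chirp c y * chirp (- c) y) * v x y"
      by (simp only: u_def mult_ac)
    then show ?thesis by simp
  qed
  have formula: "u x y = exp (\<i> / 2 * of_real c * of_real (x\<^sup>2 + y\<^sup>2)) *
      bessel_translation \<nu> x (\<lambda>s. exp (- (\<i> / 2) * of_real c * of_real (s\<^sup>2)) * f s) y" for x y
  proof -
    have "exp (- (\<i> / 2) * of_real c * of_real (s\<^sup>2)) * f s = G (s\<^sup>2)" for s
      using fG[of s] by (simp add: chirp_def mult_ac)
    moreover have "exp (\<i> / 2 * of_real c * of_real (x\<^sup>2 + y\<^sup>2)) = chirp c x * chirp c y"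
      by (simp add: chirp_def mult_exp_exp algebra_simps)
    ultimately show ?thesis
      by (simp only: u_def w_def bessel_translation_eq_parameter_integral[of _ G])
  qed
  from u unique formula show ?thesis unfolding c_def by blast
qed

end
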